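(* Let $n\ge2$ and $r\ge1$ be integers, and let the opinion graph $G=(V,E)$ be the regular rooted tree with degree $n$ and radius $r$. Let the spatial graph $\mathcal{G}=(\mathcal{V},\mathcal{E})$ be any finite connected graph, let $\tau$ be an integer with $\tau\in[r,2r)$, and let $(\zeta_t)$ be the attraction process with confidence threshold $\tau$, started from the uniform product measure, with time to fixation $T$. Then $$P(\zeta_T\equiv\mathrm{cst})\ \ge\ 1-\bigg(\frac{1}{\tau+1-r}\bigg)\bigg(\frac{n+2n^2+\cdots+rn^r}{1+n+n^2+\cdots+n^r}\bigg)=1-\bigg(\frac{1}{\tau+1-r}\bigg)\frac{n\,(rn^{r+1}-(r+1)n^r+1)}{(1-n)(1-n^{r+1})}.$$
   Context: Graphs are simple and undirected. The regular rooted tree with degree $n$ and radius $r$ is the finite rooted tree in which every vertex at distance less than $r$ from the root has exactly $n$ children and the vertices at distance $r$ from the root are leaves (so there are $n^k$ vertices at distance $k$ from the root for $k=0,1,\dots,r$). $d(\cdot,\cdot)$ is the geodesic distance on the opinion graph $G$. For $a\neq b$ in $V$, $D(a,b)=\{a'\in V:d(a,a')=1\text{ and }d(a',b)=d(a,b)-1\}$. Let $\vec{\mathcal{E}}$ be the set of directed edges $\vec{xy},\vec{yx}$ for $\{x,y\}\in\mathcal{E}$. The attraction process $(\zeta_t)$ is the continuous-time Markov chain on $V^{\mathcal{V}}$ (an opinion in $V$ at each vertex of $\mathcal{V}$), with right-continuous paths, in which each directed edge $\vec{xy}\in\vec{\mathcal{E}}$ becomes active at rate one, independently over directed edges and independently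 of $\zeta_0$. When $\vec{xy}$ becomes active and the opinions $a$ at $x$ and $b$ at $y$ satisfy $0<d(a,b)\le\tau$, the opinion at $x$ is replaced by an opinion chosen uniformly at random from $D(a,b)$; otherwise nothing changes. The time to fixation is $T=\inf\{t\ge0:\zeta_t=\zeta_s\text{ for all }s>t\}$ (with $\inf\varnothing=\infty$). The event $\{\zeta_T\equiv\mathrm{cst}\}$ is the event that $T<\infty$ and there is $c\in V$ with $\zeta_T(x)=c$ for all $x\in\mathcal{V}$. The uniform product measure is the initial distribution under which the opinions $\zeta_0(x)$, $x\in\mathcal{V}$, are independent and uniformly distributed on $V$. *)

theory Defs
  imports "HOL-Probability.Probability"
begin

section \<open>Simple graphs\<close>

definition simple_graph :: "'a set \<Rightarrow> 'a set set \<Rightarrow> bool" where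
  "simple_graph V E \<longleftrightarrow> E \<subseteq> {{x, y} | x y. x \<in> V \<and> y \<in> V \<and> x \<noteq> y}"

definition directed_edges :: "'a set set \<Rightarrow> ('a \<times> 'a) set" where
  "directed_edges E = {(x, y). {x, y} \<in> E}"

text \<open>A walk is the nonempty list of the vertices it visits; its length is the number of steps.\<close>

definition is_walk :: "'a set \<Rightarrow> 'a set set \<Rightarrow> 'a \<Rightarrow> 'a list \<Rightarrow> 'a \<Rightarrow> bool" where
  "is_walk V E a p b \<longleftrightarrow> p \<noteq> [] \<and> hd p = a \<and> last p = b \<and> set p \<subseteq> V \<and>
     (\<forall>i. Suc i < length p \<longrightarrow> {p ! i, p ! Suc i} \<in> E)"

definition connected_graph :: "'a set \<Rightarrow> 'a set set \<Rightarrow> bool" where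
  "connected_graph V E \<longleftrightarrow> (\<forall>a\<in>V. \<forall>b\<in>V. \<exists>p. is_walk V E a p b)"

definition geodesic_dist :: "'a set \<Rightarrow> 'a set set \<Rightarrow> 'a \<Rightarrow> 'a \<Rightarrow> nat" where
  "geodesic_dist V E a b = (LEAST k. \<exists>p. is_walk V E a p b \<and> length p = Suc k)"

definition closer_neighbours :: "'a set \<Rightarrow> 'a set set \<Rightarrow> 'a \<Rightarrow> 'a \<Rightarrow> 'a set" where
  "closer_neighbours V E a b =
     {a' \<in> V. geodesic_dist V E a a' = 1 \<and>
              int (geodesic_dist V E a' b) = int (geodesic_dist V E a b) - 1}"


section \<open>The regular rooted tree\<close>

text \<open>
  A vertex is the list of child indices leading to it from the root \<open>[]\<close>; the children of
  \<open>v\<close> are the vertices \<open>v @ [i]\<close> with \<open>i < n\<close>.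
\<close>

definition tree_vertices :: "nat \<Rightarrow> nat \<Rightarrow> nat list set" where
  "tree_vertices n r = {v. set v \<subseteq> {..<n} \<and> length v \<le> r}"

definition tree_edges :: "nat \<Rightarrow> nat \<Rightarrow> nat list set set" where
  "tree_edges n r = {{v, v @ [i]} | v i. v \<in> tree_vertices n r \<and> length v < r \<and> i < n}"


section \<open>Poisson processes\<close>

definition generated_events ::
    "'w measure \<Rightarrow> 'i set \<Rightarrow> ('i \<Rightarrow> 'w \<Rightarrow> 's) \<Rightarrow> 'w set set" where
  "generated_events M I X = sigma_sets (space M) {X i -` A \<inter> space M | i A. i \<in> I}"

definition right_continuous_path :: "(real \<Rightarrow> 's) \<Rightarrow> bool" where
  "right_continuous_path f \<longleftrightarrow> (\<forall>t\<ge>0. \<forall>\<^sub>F s in at_right t. f s = f t)"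

text \<open>
  The subtraction on natural numbers below is never truncated, since paths are monotone.
\<close>

definition poisson_process :: "'w measure \<Rightarrow> real \<Rightarrow> (real \<Rightarrow> 'w \<Rightarrow> nat) \<Rightarrow> bool" where
  "poisson_process M c N \<longleftrightarrow>
     (\<forall>t\<ge>0. N t \<in> measurable M (count_space UNIV)) \<and>
     (\<forall>\<omega>\<in>space M. N 0 \<omega> = 0 \<and> mono_on {0..} (\<lambda>t. N t \<omega>) \<and>
        right_continuous_path (\<lambda>t. N t \<omega>)) \<and>
     (\<forall>s t. 0 \<le> s \<and> s < t \<longrightarrow>
        distr M (count_space UNIV) (\<lambda>\<omega>. N t \<omega> - N s \<omega>)
          = measure_pmf (poisson_pmf (c * (t - s))) \<and>
        prob_space.indep_set M (generated_events M {0..s} N)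
          (generated_events M {t} (\<lambda>t \<omega>. N t \<omega> - N s \<omega>)))"

definition jumps_at :: "(real \<Rightarrow> nat) \<Rightarrow> real \<Rightarrow> bool" where
  "jumps_at f t \<longleftrightarrow> 0 < t \<and> (\<forall>s\<in>{0..<t}. f s < f t)"


section \<open>The attraction process\<close>

text \<open>
  \<open>attract V E \<tau> \<eta> (x, y) u\<close> is the configuration after the activation of the directed edge
  from \<open>x\<close> to \<open>y\<close>, where \<open>u a b\<close> is the opinion selected from \<open>closer_neighbours V E a b\<close>.
\<close>

definition attract ::
    "'v set \<Rightarrow> 'v set set \<Rightarrow> nat \<Rightarrow> ('x \<Rightarrow> 'v) \<Rightarrow> 'x \<times> 'x \<Rightarrow> ('v \<Rightarrow> 'v \<Rightarrow> 'v) \<Rightarrow> 'x \<Rightarrow> 'v" where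
  "attract V E \<tau> \<eta> = (\<lambda>(x, y) u.
     if 0 < geodesic_dist V E (\<eta> x) (\<eta> y) \<and> geodesic_dist V E (\<eta> x) (\<eta> y) \<le> \<tau>
     then \<eta>(x := u (\<eta> x) (\<eta> y)) else \<eta>)"

datatype 'x source = Initial | Clock "'x \<times> 'x" | Choice "'x \<times> 'x" nat

text \<open>
  \<open>(V, E)\<close> is the opinion graph and \<open>(S, F)\<close> the spatial graph. \<open>N e t\<close> is the number of
  activations of the directed edge \<open>e\<close> up to time \<open>t\<close>, and \<open>U e k a b\<close> is the opinion adopted at
  the \<open>k\<close>-th activation of \<open>e\<close> if the two opinions are then \<open>a\<close> and \<open>b\<close>. Only one pair
  \<open>(a, b)\<close> is relevant for each \<open>e\<close> and \<open>k\<close>, so that the joint law of \<open>U e k a b\<close> over the pairs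
  \<open>(a, b)\<close> is left open. The evolution rule is required almost surely because
  simultaneous activations, to which it assigns no meaning, form a null event.
\<close>

locale attraction_process = prob_space M
  for V :: "'v set" and E :: "'v set set"
    and S :: "'x set" and F :: "'x set set"
    and \<tau> :: nat
    and M :: "'w measure"
    and N :: "'x \<times> 'x \<Rightarrow> real \<Rightarrow> 'w \<Rightarrow> nat"
    and U :: "'x \<times> 'x \<Rightarrow> nat \<Rightarrow> 'v \<Rightarrow> 'v \<Rightarrow> 'w \<Rightarrow> 'v"
    and \<zeta> :: "real \<Rightarrow> 'w \<Rightarrow> 'x \<Rightarrow> 'v" +
  assumes state: "\<And>t. 0 \<le> t \<Longrightarrow> \<zeta> t \<in> measurable M (count_space (S \<rightarrow>\<^sub>E V))"
    and right_continuous: "\<And>\<omega>. \<omega> \<in> space M \<Longrightarrow> right_continuous_path (\<lambda>t. \<zeta> t \<omega>)"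
    and clocks: "\<And>e. e \<in> directed_edges F \<Longrightarrow> poisson_process M 1 (N e)"
    and choices_measurable:
      "\<And>e k a b. \<lbrakk>e \<in> directed_edges F; a \<in> V; b \<in> V; a \<noteq> b\<rbrakk> \<Longrightarrow>
         U e k a b \<in> measurable M (count_space UNIV)"
    and choices_uniform:
      "\<And>e k a b. \<lbrakk>e \<in> directed_edges F; a \<in> V; b \<in> V; a \<noteq> b\<rbrakk> \<Longrightarrow>
         distr M (count_space UNIV) (U e k a b)
           = measure_pmf (pmf_of_set (closer_neighbours V E a b))"
    and independent:
      "indep_sets
         (\<lambda>i. case i of
             Initial \<Rightarrow> generated_events M {0} \<zeta>
           | Clock e \<Rightarrow> generated_events M {0..} (N e)
           | Choice e k \<Rightarrow> generated_events M {(a, b). a \<in> V \<and> b \<in> V \<and> a \<noteq> b}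
                             (\<lambda>(a, b). U e k a b))
         ({Initial} \<union> Clock ` directed_edges F \<union>
          {Choice e k | e k. e \<in> directed_edges F})"
    and evolution:
      "AE \<omega> in M. \<forall>t>0. \<exists>\<eta>. (\<forall>\<^sub>F s in at_left t. \<zeta> s \<omega> = \<eta>) \<and>
         ((\<forall>e\<in>directed_edges F. \<not> jumps_at (\<lambda>s. N e s \<omega>) t) \<longrightarrow> \<zeta> t \<omega> = \<eta>) \<and>
         (\<forall>e\<in>directed_edges F. jumps_at (\<lambda>s. N e s \<omega>) t \<longrightarrow>
            \<zeta> t \<omega> = attract V E \<tau> \<eta> e (\<lambda>a b. U e (N e t \<omega>) a b \<omega>))"

definition uniform_product_initial ::
    "'v set \<Rightarrow> 'x set \<Rightarrow> 'w measure \<Rightarrow> ('w \<Rightarrow> 'x \<Rightarrow> 'v) \<Rightarrow> bool" where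
  "uniform_product_initial V S M \<xi> \<longleftrightarrow>
     prob_space.indep_vars M (\<lambda>_. count_space UNIV) (\<lambda>x \<omega>. \<xi> \<omega> x) S \<and>
     (\<forall>x\<in>S. distr M (count_space UNIV) (\<lambda>\<omega>. \<xi> \<omega> x) = measure_pmf (pmf_of_set V))"

definition fixation_time :: "(real \<Rightarrow> 's) \<Rightarrow> ereal" where
  "fixation_time f = Inf {ereal t | t. 0 \<le> t \<and> (\<forall>s>t. f t = f s)}"

definition fixates_constant :: "'v set \<Rightarrow> 'x set \<Rightarrow> (real \<Rightarrow> 'x \<Rightarrow> 'v) \<Rightarrow> bool" where
  "fixates_constant V S f \<longleftrightarrow> fixation_time f < \<infinity> \<and>
     (\<exists>c\<in>V. \<forall>x\<in>S. f (real_of_ereal (fixation_time f)) x = c)"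

end

theory Submission
  imports Defs "HOL-Library.Sublist"
begin

text \<open>
  In a tree the opinion adopted at an interaction is determined by the two opinions involved. Moving
  \<open>a\<close> towards \<open>b\<close> increases the depth of \<open>a\<close> by one if \<open>a\<close> is an ancestor of \<open>b\<close> and
  decreases it by one otherwise. Since the two directions of an edge are activated at the same rate,
  the total depth of the configuration is a supermartingale, and a strictly concave function of it
  has a drift bounded away from zero as long as some edge can still interact, so that the process
  freezes almost surely. In a frozen configuration without consensus every opinion has depth at least
  \<open>\<tau> + 1 - r\<close>, because an opinion closer to the root interacts with every other opinion and would
  have spread through the connected spatial graph. Comparing the expected total depth initially and
  after freezing gives the bound.

  The supermartingale estimates are exact for the chain that looks at time slots of length \<open>h\<close> and
  ignores the slots with more than one activation; the process agrees with this chain up to a time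
  \<open>m h\<close> with probability \<open>1 - O(m h\<^sup>2)\<close>, and \<open>h = j\<^sup>-\<^sup>2\<close>, \<open>m = j\<^sup>3\<close> lets \<open>m h\<close> tend to infinity.
\<close>

section \<open>Distances in the regular rooted tree\<close>

text \<open>The recursion strips the common prefix, that is, it descends to the deepest common
  ancestor; from there the path climbs the rest of one list and descends the rest of the other.
  \<open>geodesic_dist_tree\<close> identifies this with the geodesic distance.\<close>

fun tree_dist :: "nat list \<Rightarrow> nat list \<Rightarrow> nat" where
  "tree_dist [] b = length b"
| "tree_dist (x # a) [] = Suc (length a)"
| "tree_dist (x # a) (y # b) = (if x = y then tree_dist a b else length a + length b + 2)"

text \<open>First step of the geodesic from \<open>a\<close> to \<open>b\<close>: down if
  \<open>b\<close> lies below \<open>a\<close>, otherwise up to the parent. For \<open>a = b\<close>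
  the value is meaningless, and every use assumes \<open>a \<noteq> b\<close>.\<close>

definition step_toward :: "nat list \<Rightarrow> nat list \<Rightarrow> nat list" where
  "step_toward a b = (if prefix a b then a @ [b ! length a] else butlast a)"

lemma tree_dist_eq_0_iff: "tree_dist a b = 0 \<longleftrightarrow> a = b"
  by (induction a b rule: tree_dist.induct) auto

lemma tree_dist_le: "tree_dist a b \<le> length a + length b"
  by (induction a b rule: tree_dist.induct) auto

text \<open>Passing from a parent to a child brings \<open>b\<close> one step closer exactly when
  \<open>b\<close> lies in the subtree of the child, and one step farther otherwise. All later
  distance computations reduce to this one; integers accommodate the negative change.\<close>

lemma tree_dist_snoc:
  "int (tree_dist (a @ [i]) b) = int (tree_dist a b) + (if prefix (a @ [i]) b then - 1 else 1)"
proof (induction a b rule: tree_dist.induct)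
  case (1 b)
  show ?case by (cases b) auto
qed auto

lemma prefix_snoc_nth:
  assumes "prefix a b" "a \<noteq> b"
  shows "length a < length b" "prefix (a @ [c]) b \<longleftrightarrow> c = b ! length a"
proof -
  obtain c' z where "b = a @ c' # z" using assms by (metis append_Nil2 list.exhaust prefix_def)
  then show "length a < length b" "prefix (a @ [c]) b \<longleftrightarrow> c = b ! length a" by auto
qed

lemma tree_dist_step_toward:
  assumes "a \<noteq> b"
  shows "Suc (tree_dist (step_toward a b) b) = tree_dist a b"
proof (cases "prefix a b")
  case True
  then show ?thesis
    using tree_dist_snoc[of a "b ! length a" b] prefix_snoc_nth[OF True assms]
    by (simp add: step_toward_def)
next
  case False
  then have "a \<noteq> []" by auto
  then have "butlast a @ [last a] = a" by simp
  then show ?thesis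
    using tree_dist_snoc[of "butlast a" "last a" b] False by (simp add: step_toward_def)
qed

lemma length_step_toward:
  assumes "a \<noteq> b"
  shows "int (length (step_toward a b)) = int (length a) + (if prefix a b then 1 else - 1)"
proof -
  have "a \<noteq> []" if "\<not> prefix a b" using that by auto
  then show ?thesis by (cases a) (auto simp: step_toward_def)
qed

section \<open>Geodesics in the tree and the unique closer neighbour\<close>

lemma root_in_tree_vertices: "[] \<in> tree_vertices n r"
  by (simp add: tree_vertices_def)

lemma tree_edges_in_vertices:
  "{a, a'} \<in> tree_edges n r \<Longrightarrow> a \<in> tree_vertices n r \<and> a' \<in> tree_vertices n r"
  by (auto simp: tree_edges_def tree_vertices_def doubleton_eq_iff)

lemma tree_edge_step_toward:
  assumes a: "a \<in> tree_vertices n r" and b: "b \<in> tree_vertices n r" and "a \<noteq> b"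
  shows "{a, step_toward a b} \<in> tree_edges n r"
proof (cases "prefix a b")
  case True
  then have "length a < length b" using prefix_snoc_nth \<open>a \<noteq> b\<close> by blast
  moreover from this have "b ! length a < n"
    using b nth_mem[of "length a" b] by (auto simp: tree_vertices_def simp del: nth_mem)
  ultimately show ?thesis
    using True a b unfolding tree_edges_def step_toward_def mem_Collect_eq
    by (intro exI[of _ a] exI[of _ "b ! length a"]) (auto simp: tree_vertices_def)
next
  case False
  then have ne: "a \<noteq> []" by auto
  have "last a < n" using a last_in_set[OF ne] by (auto simp: tree_vertices_def simp del: last_in_set)
  moreover have "butlast a \<in> tree_vertices n r"
    using a by (auto simp: tree_vertices_def dest: in_set_butlastD)
  moreover have "length (butlast a) < r"
    using a ne by (cases a) (auto simp: tree_vertices_def)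
  moreover have "{a, butlast a} = {butlast a, butlast a @ [last a]}" using ne by auto
  ultimately show ?thesis
    using False unfolding tree_edges_def step_toward_def mem_Collect_eq
    by (intro exI[of _ "butlast a"] exI[of _ "last a"]) simp
qed

lemma step_toward_in_tree_vertices:
  "\<lbrakk>a \<in> tree_vertices n r; b \<in> tree_vertices n r; a \<noteq> b\<rbrakk> \<Longrightarrow> step_toward a b \<in> tree_vertices n r"
  using tree_edge_step_toward tree_edges_in_vertices by blast

lemma tree_dist_edge_le:
  assumes "{a, a'} \<in> tree_edges n r"
  shows "tree_dist a b \<le> Suc (tree_dist a' b)"
proof -
  obtain v i where "{a, a'} = {v, v @ [i]}" using assms by (auto simp: tree_edges_def)
  then show ?thesis
    using tree_dist_snoc[of v i b] by (auto simp: doubleton_eq_iff split: if_splits)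
qed

lemma is_walk_Cons:
  assumes "is_walk V E a' p b" "{a, a'} \<in> E" "a \<in> V"
  shows "is_walk V E a (a # p) b"
  using assms by (auto simp: is_walk_def nth_Cons hd_conv_nth split: nat.split)

text \<open>Upper bound for the geodesic distance: iterating \<open>step_toward\<close> lowers the
  distance by one at each step until \<open>b\<close> is reached.\<close>

lemma tree_walk_exists:
  assumes "a \<in> tree_vertices n r" "b \<in> tree_vertices n r"
  shows "\<exists>p. is_walk (tree_vertices n r) (tree_edges n r) a p b \<and> length p = Suc (tree_dist a b)"
  using assms
proof (induction "tree_dist a b" arbitrary: a)
  case 0
  then have "a = b" using tree_dist_eq_0_iff by metis
  then show ?case using 0 by (intro exI[of _ "[a]"]) (auto simp: is_walk_def)
next
  case (Suc k)
  then have ne: "a \<noteq> b" using tree_dist_eq_0_iff by (metis nat.distinct(1))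
  let ?a = "step_toward a b"
  have k: "k = tree_dist ?a b" using tree_dist_step_toward[OF ne] Suc.hyps(2) by simp
  obtain p where "is_walk (tree_vertices n r) (tree_edges n r) ?a p b" "length p = Suc k"
    using Suc.hyps(1)[OF k] Suc.prems step_toward_in_tree_vertices ne k by metis
  then show ?case
    using is_walk_Cons tree_edge_step_toward[OF Suc.prems ne] Suc.prems Suc.hyps(2)
    by (intro exI[of _ "a # p"]) auto
qed

text \<open>Lower bound for the geodesic distance: \<open>tree_dist\<close> to \<open>b\<close>
  drops by at most one along an edge and is zero at \<open>b\<close>. The inequality is strict
  because \<open>length p\<close> counts vertices, one more than the steps.\<close>

lemma tree_dist_le_walk:
  "is_walk (tree_vertices n r) (tree_edges n r) a p b \<Longrightarrow> tree_dist a b < length p"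
proof (induction p arbitrary: a)
  case Nil
  then show ?case by (simp add: is_walk_def)
next
  case (Cons c p)
  then have c: "c = a" by (simp add: is_walk_def)
  show ?case
  proof (cases p)
    case Nil
    then have "a = b" using Cons.prems by (auto simp: is_walk_def)
    then show ?thesis using tree_dist_eq_0_iff[of a b] by simp
  next
    case p: (Cons d q)
    have w: "is_walk (tree_vertices n r) (tree_edges n r) d p b"
      using Cons.prems by (fastforce simp: p is_walk_def)
    have "{a, d} \<in> tree_edges n r"
      using Cons.prems c by (force simp: p is_walk_def)
    then show ?thesis using Cons.IH[OF w] tree_dist_edge_le[of a d n r b] by simp
  qed
qed

lemma geodesic_dist_tree:
  assumes "a \<in> tree_vertices n r" "b \<in> tree_vertices n r"
  shows "geodesic_dist (tree_vertices n r) (tree_edges n r) a b = tree_dist a b"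
  unfolding geodesic_dist_def
proof (rule Least_equality)
  show "\<exists>p. is_walk (tree_vertices n r) (tree_edges n r) a p b \<and> length p = Suc (tree_dist a b)"
    using tree_walk_exists[OF assms] .
next
  fix k assume "\<exists>p. is_walk (tree_vertices n r) (tree_edges n r) a p b \<and> length p = Suc k"
  then show "tree_dist a b \<le> k" using tree_dist_le_walk by fastforce
qed

text \<open>A neighbour is a child or the parent. A child is closer only if it leads to
  \<open>b\<close>, and the parent only if \<open>b\<close> is not below \<open>a\<close>, so
  exactly one candidate remains and the random choice of the process becomes deterministic.\<close>

lemma closer_neighbours_tree:
  assumes a: "a \<in> tree_vertices n r" and b: "b \<in> tree_vertices n r" and ne: "a \<noteq> b"
  shows "closer_neighbours (tree_vertices n r) (tree_edges n r) a b = {step_toward a b}"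
proof -
  have "tree_dist a (step_toward a b) = 1"
  proof -
    have "tree_dist a (step_toward a b) \<le> 1"
      using tree_dist_edge_le[OF tree_edge_step_toward[OF assms], of "step_toward a b"]
        tree_dist_eq_0_iff[of "step_toward a b" "step_toward a b"] by simp
    moreover have "a \<noteq> step_toward a b" using tree_dist_step_toward[OF ne] by auto
    ultimately show ?thesis using tree_dist_eq_0_iff[of a "step_toward a b"] by linarith
  qed
  moreover have "c = step_toward a b"
    if c: "c \<in> tree_vertices n r" "tree_dist a c = 1" "Suc (tree_dist c b) = tree_dist a b" for c
  proof -
    \<comment> \<open>A vertex at distance one is reached by a single step, so \<open>c\<close> is
      \<open>step_toward a c\<close>, hence a child or the parent of \<open>a\<close>.\<close>
    have "a \<noteq> c" using c(2) tree_dist_eq_0_iff[of a c] by auto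
    then have "tree_dist (step_toward a c) c = 0"
      using tree_dist_step_toward[of a c] c(2) by simp
    then have eq: "step_toward a c = c" using tree_dist_eq_0_iff by blast
    show ?thesis
    proof (cases "prefix a c")
      case True
      then obtain i where i: "c = a @ [i]" using eq by (metis step_toward_def)
      then have p: "prefix (a @ [i]) b"
        using tree_dist_snoc[of a i b] c(3) by (simp split: if_splits)
      then have "prefix a b" using append_prefixD by blast
      then show ?thesis
        using prefix_snoc_nth(2)[OF _ ne, of i] p i by (simp add: step_toward_def)
    next
      case False
      then have "a \<noteq> []" by auto
      moreover have c': "butlast a = c" using eq False by (simp add: step_toward_def)
      ultimately have "c @ [last a] = a" by (metis append_butlast_last_id)
      then have "\<not> prefix a b"
        using tree_dist_snoc[of c "last a" b] c(3) by (simp split: if_splits)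
      then show ?thesis using c' by (simp add: step_toward_def)
    qed
  qed
  moreover have "c \<in> closer_neighbours (tree_vertices n r) (tree_edges n r) a b \<longleftrightarrow>
      c \<in> tree_vertices n r \<and> tree_dist a c = 1 \<and> Suc (tree_dist c b) = tree_dist a b" for c
    using a b by (auto simp: closer_neighbours_def geodesic_dist_tree)
  ultimately show ?thesis
    using step_toward_in_tree_vertices[OF assms] tree_dist_step_toward[OF ne] by blast
qed

section \<open>Mean depth of a uniform vertex\<close>

lemma finite_tree_vertices: "finite (tree_vertices n r)"
  unfolding tree_vertices_def by (rule finite_lists_length_le) simp

text \<open>Groups the vertices by depth, with \<open>n ^ k\<close> lists of length
  \<open>k\<close>. Taking \<open>g\<close> constant one gives the number of vertices, and
  \<open>g = real\<close> the sum of the depths.\<close>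

lemma sum_tree_vertices_by_depth:
  "(\<Sum>v\<in>tree_vertices n r. g (length v)) = (\<Sum>k=0..r. real n ^ k * (g k :: real))"
proof -
  have "(\<Sum>v\<in>tree_vertices n r. g (length v))
      = (\<Sum>k=0..r. \<Sum>v | v \<in> tree_vertices n r \<and> length v = k. g (length v))"
    by (rule sum.group[symmetric]) (auto simp: finite_tree_vertices, auto simp: tree_vertices_def)
  also have "\<dots> = (\<Sum>k=0..r. \<Sum>v | set v \<subseteq> {..<n} \<and> length v = k. g k)"
    by (intro sum.cong) (auto simp: tree_vertices_def)
  also have "\<dots> = (\<Sum>k=0..r. real n ^ k * g k)"
    by (intro sum.cong refl) (simp add: card_lists_length_eq)
  finally show ?thesis .
qed

lemma sum_depth_closed_form:
  fixes x :: real
  assumes "x \<noteq> 1"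
  shows "(\<Sum>k=1..r. real k * x ^ k)
    = x * (real r * x ^ (r + 1) - (real r + 1) * x ^ r + 1) / (1 - x)\<^sup>2"
proof -
  \<comment> \<open>Without the denominator the induction on \<open>r\<close> is polynomial
    algebra.\<close>
  have "(\<Sum>k=1..r. real k * x ^ k) * (1 - x)\<^sup>2
    = x * (real r * x ^ (r + 1) - (real r + 1) * x ^ r + 1)"
  proof (induction r)
    case (Suc r)
    then show ?case by (simp add: algebra_simps power2_eq_square)
  qed simp
  then show ?thesis using assms by (simp add: field_simps)
qed

text \<open>One of the two factors \<open>1 - x\<close> in the closed form of the numerator cancels
  against the geometric sum.\<close>

lemma mean_depth_closed_form:
  fixes x :: real
  assumes "1 < x"
  shows "(\<Sum>k=1..r. real k * x ^ k) / (\<Sum>k=0..r. x ^ k)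
    = x * (real r * x ^ (r + 1) - (real r + 1) * x ^ r + 1) / ((1 - x) * (1 - x ^ (r + 1)))"
proof -
  have "1 < x ^ (r + 1)" using assms by (intro one_less_power) auto
  moreover have "(\<Sum>k=0..r. x ^ k) = (1 - x ^ (r + 1)) / (1 - x)"
    using assms sum_gp0[of x r] by (simp add: atLeast0AtMost)
  moreover have "(\<Sum>k=1..r. real k * x ^ k)
    = x * (real r * x ^ (r + 1) - (real r + 1) * x ^ r + 1) / (1 - x)\<^sup>2"
    using assms by (intro sum_depth_closed_form) auto
  ultimately show ?thesis using assms by (simp add: power2_eq_square)
qed

section \<open>Total depth of a configuration\<close>

definition active_edge :: "nat \<Rightarrow> ('x \<Rightarrow> nat list) \<Rightarrow> 'x \<times> 'x \<Rightarrow> bool" where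
  "active_edge \<tau> \<sigma> e \<longleftrightarrow>
     \<sigma> (fst e) \<noteq> \<sigma> (snd e) \<and> tree_dist (\<sigma> (fst e)) (\<sigma> (snd e)) \<le> \<tau>"

text \<open>\<open>attract\<close> with the selected opinion replaced by the only possible one;
  \<open>attract_eq_move\<close> makes the link.\<close>

definition move :: "nat \<Rightarrow> ('x \<Rightarrow> nat list) \<Rightarrow> 'x \<times> 'x \<Rightarrow> 'x \<Rightarrow> nat list" where
  "move \<tau> \<sigma> e = (if active_edge \<tau> \<sigma> e
     then \<sigma>(fst e := step_toward (\<sigma> (fst e)) (\<sigma> (snd e))) else \<sigma>)"

definition frozen :: "nat \<Rightarrow> ('x \<times> 'x) set \<Rightarrow> ('x \<Rightarrow> nat list) \<Rightarrow> bool" where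
  "frozen \<tau> K \<sigma> \<longleftrightarrow> (\<forall>e\<in>K. \<not> active_edge \<tau> \<sigma> e)"

definition consensus :: "'v set \<Rightarrow> 'x set \<Rightarrow> ('x \<Rightarrow> 'v) \<Rightarrow> bool" where
  "consensus V S \<sigma> \<longleftrightarrow> (\<exists>c\<in>V. \<forall>x\<in>S. \<sigma> x = c)"

definition total_depth :: "'x set \<Rightarrow> ('x \<Rightarrow> nat list) \<Rightarrow> real" where
  "total_depth S \<sigma> = (\<Sum>x\<in>S. real (length (\<sigma> x)))"

definition depth_change :: "nat \<Rightarrow> ('x \<Rightarrow> nat list) \<Rightarrow> 'x \<times> 'x \<Rightarrow> real" where
  "depth_change \<tau> \<sigma> e = (if active_edge \<tau> \<sigma> e
     then if prefix (\<sigma> (fst e)) (\<sigma> (snd e)) then 1 else - 1 else 0)"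

lemma tree_dist_commute: "tree_dist a b = tree_dist b a"
proof (induction a b rule: tree_dist.induct)
  case (1 b)
  show ?case by (cases b) auto
qed auto

lemma active_edge_swap: "active_edge \<tau> \<sigma> (y, x) \<longleftrightarrow> active_edge \<tau> \<sigma> (x, y)"
  using tree_dist_commute[of "\<sigma> x" "\<sigma> y"] by (auto simp: active_edge_def)

lemma move_in_states:
  assumes "\<sigma> \<in> S \<rightarrow>\<^sub>E tree_vertices n r" "e \<in> S \<times> S"
  shows "move \<tau> \<sigma> e \<in> S \<rightarrow>\<^sub>E tree_vertices n r"
proof (cases "active_edge \<tau> \<sigma> e")
  case True
  have "\<sigma> (fst e) \<in> tree_vertices n r" "\<sigma> (snd e) \<in> tree_vertices n r" using assms by auto
  then have "step_toward (\<sigma> (fst e)) (\<sigma> (snd e)) \<in> tree_vertices n r"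
    using True by (intro step_toward_in_tree_vertices) (auto simp: active_edge_def)
  then show ?thesis
    using True assms by (auto simp: move_def PiE_iff extensional_def)
qed (use assms in \<open>auto simp: move_def\<close>)

lemma total_depth_move:
  assumes "finite S" "e \<in> S \<times> S"
  shows "total_depth S (move \<tau> \<sigma> e) = total_depth S \<sigma> + depth_change \<tau> \<sigma> e"
proof (cases "active_edge \<tau> \<sigma> e")
  case True
  let ?a = "\<sigma> (fst e)" and ?b = "\<sigma> (snd e)"
  have "int (length (step_toward ?a ?b)) = int (length ?a) + (if prefix ?a ?b then 1 else - 1)"
    using True by (intro length_step_toward) (auto simp: active_edge_def)
  then have "real (length (step_toward ?a ?b)) = real (length ?a) + depth_change \<tau> \<sigma> e"
    using True by (auto simp: depth_change_def split: if_splits)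
  moreover have "fst e \<in> S" using assms by auto
  moreover have "(\<Sum>x\<in>S - {fst e}. real (length ((\<sigma>(fst e := c)) x)))
      = (\<Sum>x\<in>S - {fst e}. real (length (\<sigma> x)))" for c
    by (rule sum.cong) auto
  ultimately show ?thesis
    using True assms(1) by (simp add: total_depth_def move_def sum.remove[of S "fst e"])
qed (simp add: move_def depth_change_def)

text \<open>
  Of two distinct opinions at most one is an ancestor of the other, so of the two moves along an
  active edge at most one increases the depth.
\<close>

lemma sum_depth_change_nonpos:
  assumes "finite K" "sym K"
  shows "(\<Sum>e\<in>K. depth_change \<tau> \<sigma> e) \<le> 0"
proof -
  have "bij_betw prod.swap K K"
    by (rule bij_betw_byWitness[where f' = prod.swap]) (use \<open>sym K\<close> in \<open>auto simp: sym_def\<close>)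
  \<comment> \<open>Adding the sum over the reversed edges doubles it and groups the two directions
    of each edge.\<close>
  then have swap: "(\<Sum>e\<in>K. depth_change \<tau> \<sigma> (prod.swap e)) = (\<Sum>e\<in>K. depth_change \<tau> \<sigma> e)"
    by (rule sum.reindex_bij_betw)
  have "depth_change \<tau> \<sigma> e + depth_change \<tau> \<sigma> (prod.swap e) \<le> 0" for e
  proof (cases e)
    case (Pair x y)
    show ?thesis
      using prefix_order.antisym[of "\<sigma> x" "\<sigma> y"]
      by (auto simp: Pair depth_change_def active_edge_swap[of \<tau> \<sigma> y x])
         (auto simp: active_edge_def)
  qed
  then have "(\<Sum>e\<in>K. depth_change \<tau> \<sigma> e + depth_change \<tau> \<sigma> (prod.swap e)) \<le> 0"
    by (intro sum_nonpos) auto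
  then show ?thesis using swap by (simp add: sum.distrib)
qed

lemma total_depth_drift:
  assumes "finite S" "finite K" "sym K" "K \<subseteq> S \<times> S"
  shows "(\<Sum>e\<in>K. total_depth S (move \<tau> \<sigma> e) - total_depth S \<sigma>) \<le> 0"
proof -
  have "(\<Sum>e\<in>K. total_depth S (move \<tau> \<sigma> e) - total_depth S \<sigma>) = (\<Sum>e\<in>K. depth_change \<tau> \<sigma> e)"
    using assms by (intro sum.cong) (auto simp: total_depth_move)
  then show ?thesis using sum_depth_change_nonpos[OF assms(2,3)] by simp
qed

text \<open>
  A strictly concave function of the total depth has a strictly negative drift as long as the
  configuration is not frozen, because the depth then fluctuates.
\<close>

lemma concave_depth_drift:
  assumes "finite S" "finite K" "sym K" "K \<subseteq> S \<times> S" and le: "total_depth S \<sigma> \<le> L"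
  defines "\<phi> \<equiv> \<lambda>\<sigma>. total_depth S \<sigma> * (2 * L - total_depth S \<sigma>)"
  shows "(\<Sum>e\<in>K. \<phi> (move \<tau> \<sigma> e) - \<phi> \<sigma>) \<le> - of_bool (\<not> frozen \<tau> K \<sigma>)"
proof -
  let ?D = "total_depth S \<sigma>" and ?c = "depth_change \<tau> \<sigma>"
  \<comment> \<open>Exact second-order expansion of the quadratic. Since the depth is at most
    \<open>L\<close>, the linear coefficient is nonnegative and preserves the sign of the depth
    drift, while the square subtracts one for each active edge.\<close>
  have "\<phi> (move \<tau> \<sigma> e) - \<phi> \<sigma> = 2 * (L - ?D) * ?c e - (?c e)\<^sup>2" if "e \<in> K" for e
  proof -
    have "total_depth S (move \<tau> \<sigma> e) = ?D + ?c e"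
      using that assms by (intro total_depth_move) auto
    then show ?thesis by (simp add: \<phi>_def algebra_simps power2_eq_square)
  qed
  then have "(\<Sum>e\<in>K. \<phi> (move \<tau> \<sigma> e) - \<phi> \<sigma>) = 2 * (L - ?D) * (\<Sum>e\<in>K. ?c e) - (\<Sum>e\<in>K. (?c e)\<^sup>2)"
    by (simp add: sum_subtractf sum_distrib_left)
  moreover have "2 * (L - ?D) * (\<Sum>e\<in>K. ?c e) \<le> 0"
    using sum_depth_change_nonpos[OF assms(2,3)] le by (intro mult_nonneg_nonpos) auto
  moreover have "of_bool (\<not> frozen \<tau> K \<sigma>) \<le> (\<Sum>e\<in>K. (?c e)\<^sup>2)"
  proof (cases "frozen \<tau> K \<sigma>")
    case False
    then obtain e where e: "e \<in> K" "active_edge \<tau> \<sigma> e" by (auto simp: frozen_def)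
    then have "(?c e)\<^sup>2 = 1" by (auto simp: depth_change_def)
    then show ?thesis
      using member_le_sum[of e K "\<lambda>e. (?c e)\<^sup>2"] e \<open>finite K\<close> False by auto
  qed (auto intro: sum_nonneg)
  ultimately show ?thesis by linarith
qed

lemma frozen_move: "frozen \<tau> K \<sigma> \<Longrightarrow> e \<in> K \<Longrightarrow> move \<tau> \<sigma> e = \<sigma>"
  by (simp add: frozen_def move_def)

text \<open>An opinion of depth at most \<open>\<tau> - r\<close> is within distance \<open>\<tau>\<close> of every other opinion.\<close>

lemma frozen_depth_ge:
  assumes \<sigma>: "\<sigma> \<in> S \<rightarrow>\<^sub>E tree_vertices n r" and "connected_graph S F"
    and fr: "frozen \<tau> (directed_edges F) \<sigma>"
    and nc: "\<not> consensus (tree_vertices n r) S \<sigma>" and z: "z \<in> S"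
  shows "\<tau> + 1 \<le> length (\<sigma> z) + r"
proof (rule ccontr)
  assume "\<not> ?thesis"
  then have small: "length (\<sigma> z) + r \<le> \<tau>" by simp
  have "\<sigma> y = \<sigma> z" if y: "y \<in> S" for y
  proof -
    obtain p where p: "is_walk S F z p y"
      using \<open>connected_graph S F\<close> z y by (auto simp: connected_graph_def)
    \<comment> \<open>The opinion of \<open>z\<close> spreads along a walk: it has depth at most
      \<open>\<tau> - r\<close> and the next opinion depth at most \<open>r\<close>, so they are
      within the threshold, and an inactive edge then forces equality.\<close>
    have "\<sigma> (p ! i) = \<sigma> z" if "i < length p" for i
      using that
    proof (induction i)
      case 0
      then show ?case using p by (auto simp: is_walk_def hd_conv_nth)
    next
      case (Suc i)
      have e: "(p ! i, p ! Suc i) \<in> directed_edges F"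
        using p Suc.prems by (auto simp: is_walk_def directed_edges_def)
      have "p ! Suc i \<in> S" using p Suc.prems nth_mem by (fastforce simp: is_walk_def)
      then have "\<sigma> (p ! Suc i) \<in> tree_vertices n r" using \<sigma> by auto
      then have "length (\<sigma> (p ! Suc i)) \<le> r" by (simp add: tree_vertices_def)
      then have "tree_dist (\<sigma> (p ! i)) (\<sigma> (p ! Suc i)) \<le> \<tau>"
        using Suc small tree_dist_le[of "\<sigma> (p ! i)" "\<sigma> (p ! Suc i)"] by simp
      then show ?case using fr e Suc by (auto simp: frozen_def active_edge_def)
    qed
    from this[of "length p - 1"] show ?thesis
      using p by (auto simp: is_walk_def last_conv_nth)
  qed
  moreover have "\<sigma> z \<in> tree_vertices n r" using \<sigma> z by auto
  ultimately show False using nc by (auto simp: consensus_def)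
qed

section \<open>Chains that jump with a small probability\<close>

text \<open>
  \<open>q k\<close> is the law at time \<open>k\<close> of a chain on \<open>\<Omega>\<close> which, at each step and for each \<open>e \<in> K\<close>,
  applies \<open>\<lambda>\<sigma>. mv \<sigma> e\<close> with probability \<open>p\<close>.
\<close>

locale jump_chain =
  fixes \<Omega> :: "'s set" and K :: "'e set" and mv :: "'s \<Rightarrow> 'e \<Rightarrow> 's"
    and q :: "nat \<Rightarrow> 's \<Rightarrow> real" and p :: real
  assumes p_nonneg: "0 \<le> p" and q_nonneg: "\<And>k \<sigma>. 0 \<le> q k \<sigma>"
    and q_total: "\<And>k. (\<Sum>\<sigma>\<in>\<Omega>. q k \<sigma>) = 1"
    and q_Suc: "\<And>\<phi> k. (\<Sum>\<sigma>\<in>\<Omega>. \<phi> \<sigma> * q (Suc k) \<sigma>)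
      = (\<Sum>\<sigma>\<in>\<Omega>. (\<phi> \<sigma> + p * (\<Sum>e\<in>K. \<phi> (mv \<sigma> e) - \<phi> \<sigma>)) * q k \<sigma>)"
begin

text \<open>One-step supermartingale inequality in expectation: a drift of at most
  \<open>- \<psi>\<close> costs \<open>p\<close> times the mean of \<open>\<psi>\<close>.\<close>

lemma step_le:
  assumes "\<And>\<sigma>. \<sigma> \<in> \<Omega> \<Longrightarrow> (\<Sum>e\<in>K. \<phi> (mv \<sigma> e) - \<phi> \<sigma>) \<le> - \<psi> \<sigma>"
  shows "(\<Sum>\<sigma>\<in>\<Omega>. \<phi> \<sigma> * q (Suc k) \<sigma>) \<le> (\<Sum>\<sigma>\<in>\<Omega>. \<phi> \<sigma> * q k \<sigma>) - p * (\<Sum>\<sigma>\<in>\<Omega>. \<psi> \<sigma> * q k \<sigma>)"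
proof -
  have "(\<Sum>\<sigma>\<in>\<Omega>. \<phi> \<sigma> * q (Suc k) \<sigma>) \<le> (\<Sum>\<sigma>\<in>\<Omega>. (\<phi> \<sigma> + p * (- \<psi> \<sigma>)) * q k \<sigma>)"
    unfolding q_Suc using assms p_nonneg q_nonneg
    by (intro sum_mono mult_right_mono add_left_mono mult_left_mono) auto
  then show ?thesis by (simp add: algebra_simps sum_subtractf sum_distrib_left)
qed

lemma antimono_if_drift_nonpos:
  assumes "\<And>\<sigma>. \<sigma> \<in> \<Omega> \<Longrightarrow> (\<Sum>e\<in>K. \<phi> (mv \<sigma> e) - \<phi> \<sigma>) \<le> 0"
  shows "(\<Sum>\<sigma>\<in>\<Omega>. \<phi> \<sigma> * q (Suc k) \<sigma>) \<le> (\<Sum>\<sigma>\<in>\<Omega>. \<phi> \<sigma> * q k \<sigma>)"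
  using step_le[of \<phi> "\<lambda>_. 0" k] assms by simp

lemma le_initial_if_drift_nonpos:
  assumes "\<And>\<sigma>. \<sigma> \<in> \<Omega> \<Longrightarrow> (\<Sum>e\<in>K. \<phi> (mv \<sigma> e) - \<phi> \<sigma>) \<le> 0"
  shows "(\<Sum>\<sigma>\<in>\<Omega>. \<phi> \<sigma> * q m \<sigma>) \<le> (\<Sum>\<sigma>\<in>\<Omega>. \<phi> \<sigma> * q 0 \<sigma>)"
proof (induction m)
  case (Suc m)
  then show ?case using antimono_if_drift_nonpos[OF assms] order_trans by blast
qed simp

text \<open>A Lyapunov argument. Each step spends at least \<open>p\<close> times the current
  probability of not being absorbed, out of a budget of at most \<open>C\<close>. This probability
  never increases, so its value at time \<open>m\<close> bounds every earlier expense from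
  below.\<close>

lemma prob_not_absorbed_le:
  assumes absorbing: "\<And>\<sigma> e. P \<sigma> \<Longrightarrow> e \<in> K \<Longrightarrow> mv \<sigma> e = \<sigma>"
    and drift: "\<And>\<sigma>. \<sigma> \<in> \<Omega> \<Longrightarrow> (\<Sum>e\<in>K. \<phi> (mv \<sigma> e) - \<phi> \<sigma>) \<le> - of_bool (\<not> P \<sigma>)"
    and bounds: "\<And>\<sigma>. \<sigma> \<in> \<Omega> \<Longrightarrow> 0 \<le> \<phi> \<sigma> \<and> \<phi> \<sigma> \<le> C"
  shows "real m * p * (\<Sum>\<sigma>\<in>\<Omega>. of_bool (\<not> P \<sigma>) * q m \<sigma>) \<le> C"
proof -
  define a where "a k = (\<Sum>\<sigma>\<in>\<Omega>. \<phi> \<sigma> * q k \<sigma>)" for k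
  define b where "b k = (\<Sum>\<sigma>\<in>\<Omega>. of_bool (\<not> P \<sigma>) * q k \<sigma>)" for k
  have a: "a (Suc k) \<le> a k - p * b k" for k
    unfolding a_def b_def by (rule step_le) (use drift in auto)
  \<comment> \<open>Absorbed states do not move, and elsewhere the indicator already has its largest
    value.\<close>
  have "(\<Sum>e\<in>K. of_bool (\<not> P (mv \<sigma> e)) - of_bool (\<not> P \<sigma>)) \<le> (0 :: real)" for \<sigma>
    using absorbing[of \<sigma>] by (intro sum_nonpos) (cases "P \<sigma>"; simp)
  then have b: "b (Suc k) \<le> b k" for k
    unfolding b_def by (rule antimono_if_drift_nonpos)
  have "a m + real m * p * b m \<le> a 0"
  proof (induction m)
    case (Suc m)
    have "real (Suc m) * p * b (Suc m) \<le> real (Suc m) * p * b m"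
      using b p_nonneg by (intro mult_left_mono) auto
    then show ?case using Suc a[of m] by (simp add: algebra_simps)
  qed simp
  moreover have "0 \<le> a m" unfolding a_def using bounds q_nonneg by (intro sum_nonneg) auto
  moreover have "a 0 \<le> (\<Sum>\<sigma>\<in>\<Omega>. C * q 0 \<sigma>)"
    unfolding a_def using bounds q_nonneg by (intro sum_mono mult_right_mono) auto
  then have "a 0 \<le> C" by (simp add: sum_distrib_left[symmetric] q_total)
  ultimately show ?thesis by (simp add: b_def)
qed

end

text \<open>Every state is in consensus, not frozen, or frozen without consensus. The second mass is
  controlled by \<open>prob_not_absorbed_le\<close> with budget \<open>L^2\<close>. In the third
  case the total depth is at least \<open>c\<close>, so Markov's inequality and the nonincreasing
  mean depth apply.\<close>

lemma consensus_probability_ge: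
  fixes S :: "'x set"
  assumes chain: "jump_chain (S \<rightarrow>\<^sub>E tree_vertices n r) (directed_edges F) (move \<tau>) q p"
    and S: "finite S" "S \<noteq> {}" and F: "finite (directed_edges F)" "directed_edges F \<subseteq> S \<times> S"
    and conn: "connected_graph S F" and "r \<le> \<tau>" "0 < p" "0 < m"
  defines "\<Omega> \<equiv> S \<rightarrow>\<^sub>E tree_vertices n r"
  shows "(\<Sum>\<sigma>\<in>\<Omega>. of_bool (consensus (tree_vertices n r) S \<sigma>) * q m \<sigma>)
    \<ge> 1 - (\<Sum>\<sigma>\<in>\<Omega>. total_depth S \<sigma> * q 0 \<sigma>) / ((real \<tau> + 1 - real r) * real (card S))
        - (real r * real (card S))\<^sup>2 / (real m * p)"
proof -
  let ?K = "directed_edges F"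
  interpret jump_chain \<Omega> ?K "move \<tau>" q p using chain by (simp add: \<Omega>_def)
  define c where "c = (real \<tau> + 1 - real r) * real (card S)"
  have "0 < c" using \<open>r \<le> \<tau>\<close> S by (simp add: c_def card_gt_0_iff)
  define L where "L = real r * real (card S)"
  have sym: "sym ?K" by (auto simp: sym_def directed_edges_def insert_commute)
  have depth: "0 \<le> total_depth S \<sigma>" "total_depth S \<sigma> \<le> L" if "\<sigma> \<in> \<Omega>" for \<sigma>
  proof -
    have "length (\<sigma> x) \<le> r" if "x \<in> S" for x
      using that \<open>\<sigma> \<in> \<Omega>\<close> by (auto simp: \<Omega>_def tree_vertices_def)
    then have "total_depth S \<sigma> \<le> (\<Sum>x\<in>S. real r)"
      unfolding total_depth_def by (intro sum_mono) auto
    then show "total_depth S \<sigma> \<le> L" by (simp add: L_def mult.commute)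
  qed (simp add: total_depth_def sum_nonneg)
  let ?N = "\<Sum>\<sigma>\<in>\<Omega>. of_bool (\<not> frozen \<tau> ?K \<sigma>) * q m \<sigma>"
  have "real m * p * ?N \<le> L\<^sup>2"
  proof (rule prob_not_absorbed_le)
    fix \<sigma> assume "\<sigma> \<in> \<Omega>"
    let ?D = "total_depth S \<sigma>"
    \<comment> \<open>Completing the square: the potential equals
      \<open>L^2 - (L - ?D)^2\<close>.\<close>
    have "0 \<le> (L - ?D)\<^sup>2" by simp
    then have "?D * (2 * L - ?D) \<le> L\<^sup>2" by (simp add: power2_eq_square algebra_simps)
    then show "0 \<le> ?D * (2 * L - ?D) \<and> ?D * (2 * L - ?D) \<le> L\<^sup>2"
      using depth[OF \<open>\<sigma> \<in> \<Omega>\<close>] by auto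
  qed (use frozen_move concave_depth_drift[OF S(1) F(1) sym F(2) depth(2)] in auto)
  then have N: "?N \<le> L\<^sup>2 / (real m * p)"
    using \<open>0 < p\<close> \<open>0 < m\<close> by (simp add: field_simps)
  let ?A = "\<Sum>\<sigma>\<in>\<Omega>. of_bool (frozen \<tau> ?K \<sigma> \<and> \<not> consensus (tree_vertices n r) S \<sigma>) * q m \<sigma>"
  have "c * of_bool (frozen \<tau> ?K \<sigma> \<and> \<not> consensus (tree_vertices n r) S \<sigma>) \<le> total_depth S \<sigma>"
    if "\<sigma> \<in> \<Omega>" for \<sigma>
  proof (cases "frozen \<tau> ?K \<sigma> \<and> \<not> consensus (tree_vertices n r) S \<sigma>")
    case True
    have "real \<tau> + 1 - real r \<le> real (length (\<sigma> z))" if "z \<in> S" for z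
      using frozen_depth_ge[of \<sigma> S n r F \<tau> z] True that \<open>\<sigma> \<in> \<Omega>\<close> conn by (simp add: \<Omega>_def)
    then have "(\<Sum>z\<in>S. real \<tau> + 1 - real r) \<le> total_depth S \<sigma>"
      unfolding total_depth_def by (intro sum_mono) auto
    then show ?thesis using True by (simp add: c_def mult.commute)
  qed (use depth(1)[OF that] in auto)
  then have "(\<Sum>\<sigma>\<in>\<Omega>. c * of_bool (frozen \<tau> ?K \<sigma> \<and> \<not> consensus (tree_vertices n r) S \<sigma>) * q m \<sigma>)
      \<le> (\<Sum>\<sigma>\<in>\<Omega>. total_depth S \<sigma> * q m \<sigma>)"
    using q_nonneg by (intro sum_mono mult_right_mono) auto
  also have "\<dots> \<le> (\<Sum>\<sigma>\<in>\<Omega>. total_depth S \<sigma> * q 0 \<sigma>)"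
    by (rule le_initial_if_drift_nonpos) (rule total_depth_drift[OF S(1) F(1) sym F(2)])
  finally have "c * ?A \<le> (\<Sum>\<sigma>\<in>\<Omega>. total_depth S \<sigma> * q 0 \<sigma>)"
    by (simp add: sum_distrib_left mult.assoc)
  then have A: "?A \<le> (\<Sum>\<sigma>\<in>\<Omega>. total_depth S \<sigma> * q 0 \<sigma>) / c"
    using \<open>0 < c\<close> by (simp add: field_simps)
  have "1 = (\<Sum>\<sigma>\<in>\<Omega>. q m \<sigma>)" by (simp add: q_total)
  also have "\<dots> \<le> (\<Sum>\<sigma>\<in>\<Omega>. of_bool (consensus (tree_vertices n r) S \<sigma>) * q m \<sigma>
      + of_bool (\<not> frozen \<tau> ?K \<sigma>) * q m \<sigma>
      + of_bool (frozen \<tau> ?K \<sigma> \<and> \<not> consensus (tree_vertices n r) S \<sigma>) * q m \<sigma>)"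
    by (rule sum_mono) (auto simp: q_nonneg)
  finally show ?thesis using A N by (simp add: sum.distrib c_def L_def)
qed

section \<open>Piecewise constant paths\<close>

text \<open>Induction over the reals. At the infimum of the counterexamples the left condition
  restores \<open>P\<close>, and the right condition then excludes counterexamples on a whole
  interval after it, a contradiction.\<close>

lemma real_induct_ge:
  fixes P :: "real \<Rightarrow> bool"
  assumes "P a" and right: "\<And>u. a \<le> u \<Longrightarrow> P u \<Longrightarrow> \<forall>\<^sub>F v in at_right u. P v"
    and left: "\<And>u. a < u \<Longrightarrow> (\<And>v. a \<le> v \<Longrightarrow> v < u \<Longrightarrow> P v) \<Longrightarrow> P u"
    and "a \<le> b"
  shows "P b"
proof (rule ccontr)
  assume "\<not> P b"
  define B where "B = {v. a \<le> v \<and> \<not> P v}"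
  have B: "b \<in> B" "bdd_below B" using \<open>a \<le> b\<close> \<open>\<not> P b\<close> by (auto simp: B_def bdd_below_def)
  define i where "i = Inf B"
  have "a \<le> i" unfolding i_def using B by (intro cInf_greatest) (auto simp: B_def)
  have below: "P v" if "a \<le> v" "v < i" for v
    using that cInf_lower[OF _ B(2), of v] by (auto simp: B_def i_def)
  then have "P i" using left[of i] \<open>P a\<close> \<open>a \<le> i\<close> by (cases "a = i") auto
  then obtain c where c: "i < c" "\<And>v. i < v \<Longrightarrow> v < c \<Longrightarrow> P v"
    using right[OF \<open>a \<le> i\<close>] by (auto simp: eventually_at_right_field)
  have "c \<le> v" if "v \<in> B" for v
    using that c(2)[of v] below[of v] \<open>P i\<close> by (cases v i rule: linorder_cases) (auto simp: B_def not_less[symmetric])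
  then have "c \<le> i" unfolding i_def using B by (intro cInf_greatest) auto
  then show False using c by simp
qed

lemma left_limit_eq_constant:
  fixes u :: real
  assumes "\<forall>\<^sub>F s in at_left u. f s = \<eta>" "a < u" "\<And>v. a \<le> v \<Longrightarrow> v < u \<Longrightarrow> f v = c"
  shows "\<eta> = c"
proof -
  have "\<forall>\<^sub>F s in at_left u. a \<le> s \<and> s < u"
    using \<open>a < u\<close> by (auto simp: eventually_at_left_field intro: exI[of _ a])
  with assms(1) have "\<forall>\<^sub>F s in at_left u. \<eta> = c"
    by eventually_elim (use assms(3) in auto)
  then show ?thesis by simp
qed

text \<open>Pathwise properties shared by almost all trajectories, isolated so that the arguments
  inside involve no probability.\<close>

locale jump_path =
  fixes K :: "'e set" and f :: "real \<Rightarrow> 's" and N :: "'e \<Rightarrow> real \<Rightarrow> nat" and mv :: "'s \<Rightarrow> 'e \<Rightarrow> 's"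
  assumes f_right: "right_continuous_path f"
    and N_right: "\<And>e. e \<in> K \<Longrightarrow> right_continuous_path (N e)"
    and N_mono: "\<And>e s t. \<lbrakk>e \<in> K; 0 \<le> s; s \<le> t\<rbrakk> \<Longrightarrow> N e s \<le> N e t"
    and jump: "\<And>t. 0 < t \<Longrightarrow> \<exists>\<eta>. (\<forall>\<^sub>F s in at_left t. f s = \<eta>) \<and>
      ((\<forall>e\<in>K. \<not> jumps_at (N e) t) \<longrightarrow> f t = \<eta>) \<and> (\<forall>e\<in>K. jumps_at (N e) t \<longrightarrow> f t = mv \<eta> e)"
begin

text \<open>Real induction: right continuity carries the value forward, and at a left limit no clock
  can jump because monotonicity keeps its count between the equal values at \<open>a\<close> and
  \<open>b\<close>.\<close>

lemma constant_if_no_events: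
  assumes "0 \<le> a" "a \<le> b" and no: "\<And>e. e \<in> K \<Longrightarrow> N e b = N e a"
  shows "f b = f a"
proof -
  \<comment> \<open>The guard \<open>u \<le> b\<close> lets the induction run over all
    \<open>u\<close> from \<open>a\<close> on, although the clocks are controlled only up to
    \<open>b\<close>.\<close>
  have "b \<le> b \<longrightarrow> f b = f a"
  proof (rule real_induct_ge[where P = "\<lambda>u. u \<le> b \<longrightarrow> f u = f a" and a = a])
    fix u assume u: "a \<le> u" "u \<le> b \<longrightarrow> f u = f a"
    have "\<forall>\<^sub>F v in at_right u. f v = f u"
      using f_right u \<open>0 \<le> a\<close> by (auto simp: right_continuous_path_def)
    moreover have "\<forall>\<^sub>F v in at_right u. u < v" by (rule eventually_at_right_less)
    ultimately show "\<forall>\<^sub>F v in at_right u. v \<le> b \<longrightarrow> f v = f a"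
      by eventually_elim (use u in auto)
  next
    fix u assume u: "a < u" and IH: "\<And>v. a \<le> v \<Longrightarrow> v < u \<Longrightarrow> v \<le> b \<longrightarrow> f v = f a"
    show "u \<le> b \<longrightarrow> f u = f a"
    proof
      assume "u \<le> b"
      obtain \<eta> where \<eta>: "\<forall>\<^sub>F s in at_left u. f s = \<eta>" "(\<forall>e\<in>K. \<not> jumps_at (N e) u) \<longrightarrow> f u = \<eta>"
        using jump[of u] u \<open>0 \<le> a\<close> by auto
      have "\<not> jumps_at (N e) u" if "e \<in> K" for e
      proof -
        have "N e u \<le> N e a" using N_mono[OF that, of u b] no[OF that] u \<open>0 \<le> a\<close> \<open>u \<le> b\<close> by simp
        then show ?thesis using u \<open>0 \<le> a\<close> unfolding jumps_at_def
          by (metis atLeastLessThan_iff not_less)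
      qed
      moreover have "\<eta> = f a"
      proof (rule left_limit_eq_constant[OF \<eta>(1) u])
        fix v assume "a \<le> v" "v < u"
        then show "f v = f a" using IH[of v] \<open>u \<le> b\<close> by simp
      qed
      ultimately show "f u = f a" using \<eta>(2) by blast
    qed
  qed (use \<open>a \<le> b\<close> in auto)
  then show ?thesis by simp
qed

text \<open>The activation happens at the infimum \<open>u\<close> of the times at which the count
  of \<open>e\<close> has changed; right continuity of the clock puts the change at \<open>u\<close>
  itself. The path is constant on both sides of \<open>u\<close>, so only the jump rule at
  \<open>u\<close> acts.\<close>

lemma single_event:
  assumes "0 \<le> a" "a \<le> b" and e: "e \<in> K" and one: "N e b = Suc (N e a)"
    and no: "\<And>e'. e' \<in> K \<Longrightarrow> e' \<noteq> e \<Longrightarrow> N e' b = N e' a"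
  shows "f b = mv (f a) e"
proof -
  define J where "J = {v. a \<le> v \<and> v \<le> b \<and> N e v \<noteq> N e a}"
  have J: "b \<in> J" "bdd_below J" using assms by (auto simp: J_def bdd_below_def)
  define u where "u = Inf J"
  have u: "a \<le> u" "u \<le> b"
    unfolding u_def using J by (auto intro!: cInf_greatest cInf_lower simp: J_def)
  have before: "N e v = N e a" if "a \<le> v" "v < u" for v
    using that cInf_lower[OF _ J(2), of v] u by (auto simp: J_def u_def)
  have "N e u \<noteq> N e a"
  proof
    assume eq: "N e u = N e a"
    have "\<forall>\<^sub>F s in at_right u. N e s = N e u"
      using N_right[OF e] u \<open>0 \<le> a\<close> by (auto simp: right_continuous_path_def)
    then obtain c where c: "u < c" "\<And>v. u < v \<Longrightarrow> v < c \<Longrightarrow> N e v = N e u"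
      by (auto simp: eventually_at_right_field)
    have "c \<le> v" if "v \<in> J" for v
      using that c(2)[of v] before[of v] eq
      by (cases v u rule: linorder_cases) (auto simp: J_def not_less[symmetric])
    then have "c \<le> u" unfolding u_def using J by (intro cInf_greatest) auto
    then show False using c by simp
  qed
  then have Nu: "N e u = Suc (N e a)" and "a < u"
    using N_mono[OF e, of a u] N_mono[OF e, of u b] u one \<open>0 \<le> a\<close> by (auto simp: less_le)
  have jmp: "jumps_at (N e) u"
    unfolding jumps_at_def
  proof (intro conjI ballI)
    fix v assume v: "v \<in> {0..<u}"
    show "N e v < N e u"
    proof (cases "a \<le> v")
      case True
      then show ?thesis using before[of v] v Nu by simp
    next
      case False
      then show ?thesis using N_mono[OF e, of v a] v Nu by simp
    qed
  qed (use \<open>0 \<le> a\<close> \<open>a < u\<close> in auto)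
  obtain \<eta> where \<eta>: "\<forall>\<^sub>F s in at_left u. f s = \<eta>" "f u = mv \<eta> e"
    using jump[of u] \<open>0 \<le> a\<close> \<open>a < u\<close> e jmp by auto
  have other: "N e' v = N e' a" if "e' \<in> K" "e' \<noteq> e" "a \<le> v" "v \<le> b" for e' v
    using N_mono[OF that(1), of a v] N_mono[OF that(1), of v b] no[OF that(1,2)] that \<open>0 \<le> a\<close>
    by simp
  have "\<eta> = f a"
  proof (rule left_limit_eq_constant[OF \<eta>(1) \<open>a < u\<close>])
    fix v assume v: "a \<le> v" "v < u"
    show "f v = f a"
    proof (rule constant_if_no_events[OF \<open>0 \<le> a\<close> v(1)])
      fix e' assume "e' \<in> K"
      then show "N e' v = N e' a"
        using before[OF v] other[of e' v] v u by (cases "e' = e") auto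
    qed
  qed
  moreover have "f b = f u"
  proof (rule constant_if_no_events)
    fix e' assume "e' \<in> K"
    then show "N e' b = N e' u" using Nu one no other[of e' u] u by (cases "e' = e") auto
  qed (use u \<open>0 \<le> a\<close> in auto)
  ultimately show ?thesis using \<eta>(2) by simp
qed

text \<open>The jump rule returns the left limit whether or not a clock jumps, so real induction
  never leaves the absorbing state.\<close>

lemma constant_if_absorbed:
  assumes "0 \<le> a" and abs: "\<And>e. e \<in> K \<Longrightarrow> mv (f a) e = f a" and "a \<le> b"
  shows "f b = f a"
proof (rule real_induct_ge[where P = "\<lambda>u. f u = f a" and a = a])
  fix u assume u: "a \<le> u" "f u = f a"
  have "\<forall>\<^sub>F v in at_right u. f v = f u"
    using f_right \<open>0 \<le> a\<close> u(1) by (auto simp: right_continuous_path_def)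
  then show "\<forall>\<^sub>F v in at_right u. f v = f a" using u by simp
next
  fix u assume u: "a < u" and IH: "\<And>v. a \<le> v \<Longrightarrow> v < u \<Longrightarrow> f v = f a"
  obtain \<eta> where \<eta>: "\<forall>\<^sub>F s in at_left u. f s = \<eta>" "(\<forall>e\<in>K. \<not> jumps_at (N e) u) \<longrightarrow> f u = \<eta>"
    "\<forall>e\<in>K. jumps_at (N e) u \<longrightarrow> f u = mv \<eta> e"
    using jump[of u] u \<open>0 \<le> a\<close> by auto
  have "\<eta> = f a" by (rule left_limit_eq_constant[OF \<eta>(1) u IH])
  then show "f u = f a" using \<eta>(2,3) abs by metis
qed (use assms in auto)

end

section \<open>The fixation time of a right-continuous path\<close>

lemma fixation_time_attained:
  assumes rc: "right_continuous_path f" and t: "0 \<le> t" "\<forall>s>t. f t = f s"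
  shows "fixation_time f < \<infinity>" "f (real_of_ereal (fixation_time f)) = f t"
proof -
  define A where "A = {t. 0 \<le> t \<and> (\<forall>s>t. f t = f s)}"
  have A: "t \<in> A" "bdd_below A" using t by (auto simp: A_def bdd_below_def)
  define T where "T = Inf A"
  have "0 \<le> T" unfolding T_def using A by (intro cInf_greatest) (auto simp: A_def)
  have "fixation_time f = Inf (ereal ` A)"
    unfolding fixation_time_def A_def by (rule arg_cong[where f = Inf]) auto
  also have "\<dots> = ereal T"
    unfolding T_def using ereal_Inf'[OF A(2)] A(1) by force
  finally have ft: "fixation_time f = ereal T" .
  then show "fixation_time f < \<infinity>" by simp
  have after: "f s = f t" if "T < s" for s
  proof -
    obtain t' where t': "t' \<in> A" "t' < s" using \<open>T < s\<close> cInf_lessD[of A s] A unfolding T_def by blast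
    have "f t' = f v" if "t' < v" for v
      using t'(1) that unfolding A_def by blast
    then have const: "f v = f t'" if "t' < v" for v using that by metis
    \<comment> \<open>A time beyond both \<open>s\<close> and \<open>t\<close>, at which the
      constant values after \<open>t'\<close> and after \<open>t\<close> can be compared.\<close>
    have "f (max s t + 1) = f t'" using t'(2) by (intro const) linarith
    moreover have "t < max s t + 1" by linarith
    then have "f t = f (max s t + 1)" using t(2) by blast
    ultimately show ?thesis using const[OF t'(2)] by simp
  qed
  have "\<forall>\<^sub>F s in at_right T. f s = f T"
    using rc \<open>0 \<le> T\<close> by (auto simp: right_continuous_path_def)
  moreover have "\<forall>\<^sub>F s in at_right T. T < s" by (rule eventually_at_right_less)
  ultimately have "\<forall>\<^sub>F s in at_right T. f T = f t"
    by eventually_elim (use after in metis)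
  then show "f (real_of_ereal (fixation_time f)) = f t" by (simp add: ft)
qed

text \<open>The right-hand side involves only countably many times, which makes it a measurable event.\<close>

lemma fixates_constant_iff:
  assumes rc: "right_continuous_path f"
  shows "fixates_constant V S f \<longleftrightarrow>
    (\<exists>n::nat. consensus V S (f (real n)) \<and> (\<forall>q::rat. 0 \<le> q \<longrightarrow> f (real n + of_rat q) = f (real n)))"
proof
  assume fc: "fixates_constant V S f"
  \<comment> \<open>The infimum of the empty set is infinite, so a finite fixation time supplies an
    actual time \<open>t\<close> after which the path is constant.\<close>
  then have "Inf {ereal t | t. 0 \<le> t \<and> (\<forall>s>t. f t = f s)} \<noteq> Inf {}"
    unfolding fixates_constant_def fixation_time_def Inf_empty top_ereal_def by simp
  then have "{ereal t | t. 0 \<le> t \<and> (\<forall>s>t. f t = f s)} \<noteq> {}" by metis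
  then obtain t where t: "0 \<le> t" "\<forall>s>t. f t = f s" by auto
  obtain n :: nat where n: "t < real n" using reals_Archimedean2 by blast
  then have "f (real n) = f t" using t by simp
  moreover have "f (real n + of_rat q) = f t" if "0 \<le> q" for q
  proof -
    have "(0::real) \<le> of_rat q" using that by simp
    then have "t < real n + of_rat q" using n by linarith
    then show ?thesis using t by simp
  qed
  moreover have "consensus V S (f t)"
    using fc fixation_time_attained(2)[OF rc t]
    by (simp add: fixates_constant_def consensus_def)
  ultimately show "\<exists>n::nat. consensus V S (f (real n)) \<and>
      (\<forall>q::rat. 0 \<le> q \<longrightarrow> f (real n + of_rat q) = f (real n))"
    by (intro exI[of _ n]) auto
next
  assume "\<exists>n::nat. consensus V S (f (real n)) \<and>
    (\<forall>q::rat. 0 \<le> q \<longrightarrow> f (real n + of_rat q) = f (real n))"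
  then obtain n :: nat where n: "consensus V S (f (real n))"
    "\<And>q::rat. 0 \<le> q \<Longrightarrow> f (real n + of_rat q) = f (real n)" by auto
  have "f (real n) = f s" if "real n < s" for s
  proof -
    have "\<forall>\<^sub>F v in at_right s. f v = f s"
      using rc that by (auto simp: right_continuous_path_def)
    then obtain c where c: "s < c" "\<And>v. s < v \<Longrightarrow> v < c \<Longrightarrow> f v = f s"
      by (auto simp: eventually_at_right_field)
    \<comment> \<open>A rational shift that lands just to the right of \<open>s\<close>, where
      \<open>f\<close> still has the value \<open>f s\<close>.\<close>
    obtain q :: rat where q: "s - real n < of_rat q" "of_rat q < c - real n"
      using of_rat_dense[of "s - real n" "c - real n"] c(1) by auto
    have "(0::real) < of_rat q" using q(1) that by linarith
    then have "0 \<le> q" by simp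
    then have "f (real n + of_rat q) = f (real n)" by (rule n(2))
    moreover have "f (real n + of_rat q) = f s" using q by (intro c(2)) auto
    ultimately show ?thesis by simp
  qed
  then show "fixates_constant V S f"
    using fixation_time_attained[OF rc, of "real n"] n(1)
    by (simp add: fixates_constant_def consensus_def)
qed

section \<open>Independence of past and future activations\<close>

lemma generated_eventsI: "i \<in> I \<Longrightarrow> {\<omega> \<in> space M. P (X i \<omega>)} \<in> generated_events M I X"
  unfolding generated_events_def
  by (rule sigma_sets.Basic) (auto intro!: exI[of _ i] exI[of _ "Collect P"])

lemma sigma_algebra_generated_events: "sigma_algebra (space M) (generated_events M I X)"
  unfolding generated_events_def by (rule sigma_algebra_sigma_sets) auto

lemma generated_events_mono: "I \<subseteq> J \<Longrightarrow> generated_events M I X \<subseteq> generated_events M J X"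
  unfolding generated_events_def by (rule sigma_sets_mono') auto

lemma Int_stable_generated_events: "Int_stable (generated_events M I X)"
proof -
  interpret sigma_algebra "space M" "generated_events M I X" by (rule sigma_algebra_generated_events)
  show ?thesis by (auto simp: Int_stable_def)
qed

text \<open>Places the increments of a clock among the events of that clock, so that they inherit
  the independence from the other clocks. Counts are integers, so an increment event is a countable
  union over the two values.\<close>

lemma increment_events_subset:
  fixes X :: "real \<Rightarrow> 'w \<Rightarrow> nat"
  assumes "0 \<le> s" "0 \<le> t"
  shows "generated_events M {t} (\<lambda>t \<omega>. X t \<omega> - X s \<omega>) \<subseteq> generated_events M {0..} X"
proof -
  interpret G: sigma_algebra "space M" "generated_events M {0..} X"
    by (rule sigma_algebra_generated_events)
  have "(\<lambda>\<omega>. X t \<omega> - X s \<omega>) -` A \<inter> space M \<in> generated_events M {0..} X" for A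
  proof -
    have "(\<lambda>\<omega>. X t \<omega> - X s \<omega>) -` A \<inter> space M
      = (\<Union>i. \<Union>j\<in>{j. i - j \<in> A}. {\<omega> \<in> space M. X t \<omega> = i} \<inter> {\<omega> \<in> space M. X s \<omega> = j})"
      by auto
    also have "\<dots> \<in> generated_events M {0..} X"
      using assms generated_eventsI[of _ "{0..}" M "\<lambda>k. k = _" X]
      by (intro G.countable_UN'' G.Int) auto
    finally show ?thesis .
  qed
  then show ?thesis
    unfolding generated_events_def[of M "{t}"]
    by (intro G.sigma_sets_subset) auto
qed

section \<open>The initial configuration and the clocks of the process on a tree\<close>

locale tree_attraction = attraction_process "tree_vertices n r" "tree_edges n r" S F \<tau> M N U \<zeta>
  for n r \<tau> :: nat and S :: "'x set" and F :: "'x set set" and M :: "'w measure"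
    and N :: "'x \<times> 'x \<Rightarrow> real \<Rightarrow> 'w \<Rightarrow> nat"
    and U :: "'x \<times> 'x \<Rightarrow> nat \<Rightarrow> nat list \<Rightarrow> nat list \<Rightarrow> 'w \<Rightarrow> nat list"
    and \<zeta> :: "real \<Rightarrow> 'w \<Rightarrow> 'x \<Rightarrow> nat list" +
  assumes simple: "simple_graph S F" and finite_sites: "finite S"
begin

abbreviation "V \<equiv> tree_vertices n r"
abbreviation "K \<equiv> directed_edges F"
abbreviation "\<Omega> \<equiv> S \<rightarrow>\<^sub>E V"

lemma edges_subset: "K \<subseteq> S \<times> S"
  using simple by (fastforce simp: simple_graph_def directed_edges_def doubleton_eq_iff)

lemma finite_edges: "finite K"
  using edges_subset finite_sites finite_subset by blast

lemma finite_states: "finite \<Omega>"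
  using finite_sites finite_tree_vertices by (intro finite_PiE) auto

lemma state_in: "0 \<le> t \<Longrightarrow> \<omega> \<in> space M \<Longrightarrow> \<zeta> t \<omega> \<in> \<Omega>"
  using measurable_space[OF state] by auto

lemma clock_mono: "e \<in> K \<Longrightarrow> \<omega> \<in> space M \<Longrightarrow> 0 \<le> s \<Longrightarrow> s \<le> t \<Longrightarrow> N e s \<omega> \<le> N e t \<omega>"
  using clocks[of e] by (auto simp: poisson_process_def mono_on_def)

lemma increment_prob:
  assumes "e \<in> K" "0 \<le> s" "s < t"
  shows "prob {\<omega> \<in> space M. N e t \<omega> - N e s \<omega> = k} = (t - s) ^ k / fact k * exp (- (t - s))"
proof -
  have pp: "poisson_process M 1 (N e)" using clocks assms by blast
  then have N[measurable]: "N e t \<in> measurable M (count_space UNIV)" "N e s \<in> measurable M (count_space UNIV)"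
    using assms by (auto simp: poisson_process_def)
  have D: "(\<lambda>\<omega>. N e t \<omega> - N e s \<omega>) \<in> measurable M (count_space UNIV)" by measurable
  have "distr M (count_space UNIV) (\<lambda>\<omega>. N e t \<omega> - N e s \<omega>) = measure_pmf (poisson_pmf (1 * (t - s)))"
    using pp assms by (auto simp: poisson_process_def)
  then have "measure (measure_pmf (poisson_pmf (t - s))) {k}
      = prob ((\<lambda>\<omega>. N e t \<omega> - N e s \<omega>) -` {k} \<inter> space M)"
    using measure_distr[OF D, of "{k}"] by simp
  also have "(\<lambda>\<omega>. N e t \<omega> - N e s \<omega>) -` {k} \<inter> space M = {\<omega> \<in> space M. N e t \<omega> - N e s \<omega> = k}"
    by auto
  finally show ?thesis using assms by (simp add: measure_pmf_single)
qed

text \<open>Marginalises \<open>independent\<close> to the initial configuration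
  (\<open>None\<close>) and the clocks (\<open>Some e\<close>). On a tree the choices are almost
  surely constant, so these sources carry the randomness.\<close>

lemma clock_independent: "indep_sets (\<lambda>i. case i of None \<Rightarrow> generated_events M {0} \<zeta>
    | Some e \<Rightarrow> generated_events M {0..} (N e)) (insert None (Some ` K))"
proof -
  let ?s = "\<lambda>i. case i of None \<Rightarrow> Initial | Some e \<Rightarrow> Clock e"
  let ?G = "\<lambda>i. case i of Initial \<Rightarrow> generated_events M {0} \<zeta>
    | Clock e \<Rightarrow> generated_events M {0..} (N e)
    | Choice e k \<Rightarrow> generated_events M {(a, b). a \<in> V \<and> b \<in> V \<and> a \<noteq> b} (\<lambda>(a, b). U e k a b)"
  let ?I = "{Initial} \<union> Clock ` K \<union> {Choice e k | e k. e \<in> K}"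
  have sub: "?G i \<subseteq> events" if "i \<in> ?I" for i
    using independent that unfolding indep_sets_def by blast
  show ?thesis
  proof (rule indep_setsI)
    fix i assume "i \<in> insert None (Some ` K)"
    then show "(case i of None \<Rightarrow> generated_events M {0} \<zeta>
      | Some e \<Rightarrow> generated_events M {0..} (N e)) \<subseteq> events"
      using sub[of "?s i"] by (elim insertE imageE) simp_all
  next
    fix A J assume J: "J \<noteq> {}" "J \<subseteq> insert None (Some ` K)" "finite J"
      and A: "\<forall>j\<in>J. A j \<in> (case j of None \<Rightarrow> generated_events M {0} \<zeta>
        | Some e \<Rightarrow> generated_events M {0..} (N e))"
    define B where "B i = A (case i of Initial \<Rightarrow> None | Clock e \<Rightarrow> Some e)" for i
    have inj: "inj_on ?s J" by (auto simp: inj_on_def split: option.splits)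
    have BA: "B (?s j) = A j" for j by (auto simp: B_def split: option.split)
    have "prob (\<Inter>i\<in>?s ` J. B i) = (\<Prod>i\<in>?s ` J. prob (B i))"
    proof (rule indep_setsD[OF independent])
      show "?s ` J \<subseteq> ?I"
        using J(2) by (auto split: option.splits)
      have "B (?s j) \<in> ?G (?s j)" if "j \<in> J" for j
        using bspec[OF A that] by (cases j) (simp_all add: B_def)
      then show "\<forall>i\<in>?s ` J. B i \<in> ?G i" by blast
    qed (use J in auto)
    then show "prob (\<Inter>j\<in>J. A j) = (\<Prod>j\<in>J. prob (A j))"
      by (simp add: prod.reindex[OF inj] BA)
  qed
qed

text \<open>History of the initial configuration and of the clocks; the slot chain, driven by the
  deterministic \<open>move\<close>, is adapted to it (\<open>chain_past\<close>).\<close>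

definition past :: "real \<Rightarrow> 'w set set" where
  "past s = sigma_sets (space M) (generated_events M {0} \<zeta> \<union> (\<Union>e\<in>K. generated_events M {0..s} (N e)))"

definition increments_are :: "real \<Rightarrow> real \<Rightarrow> ('x \<times> 'x \<Rightarrow> nat) \<Rightarrow> 'w set" where
  "increments_are s t c = {\<omega> \<in> space M. \<forall>e\<in>K. N e t \<omega> - N e s \<omega> = c e}"

lemma generated_events_in_events:
  "generated_events M {0} \<zeta> \<subseteq> events" "e \<in> K \<Longrightarrow> generated_events M {0..} (N e) \<subseteq> events"
proof -
  have "\<forall>i\<in>insert None (Some ` K). (case i of None \<Rightarrow> generated_events M {0} \<zeta>
      | Some e \<Rightarrow> generated_events M {0..} (N e)) \<subseteq> events"
    using clock_independent unfolding indep_sets_def by (rule conjunct1)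
  then show "generated_events M {0} \<zeta> \<subseteq> events"
    "e \<in> K \<Longrightarrow> generated_events M {0..} (N e) \<subseteq> events" by simp_all
qed

lemma past_generators_in_events:
  "generated_events M {0} \<zeta> \<union> (\<Union>e\<in>K. generated_events M {0..s} (N e)) \<subseteq> events"
proof -
  have "generated_events M {0..s} (N e) \<subseteq> events" if "e \<in> K" for e
    using generated_events_in_events(2)[OF that] generated_events_mono[of "{0..s}" "{0..}" M "N e"]
    by auto
  then show ?thesis using generated_events_in_events(1) by blast
qed

lemma sigma_algebra_past: "sigma_algebra (space M) (past s)"
  unfolding past_def
  by (intro sigma_algebra_sigma_sets subset_trans[OF past_generators_in_events sets.space_closed])

lemma past_in_events: "past s \<subseteq> events"
  unfolding past_def by (intro sets.sigma_sets_subset past_generators_in_events)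

lemma past_mono: "s \<le> t \<Longrightarrow> past s \<subseteq> past t"
  unfolding past_def
  by (intro sigma_sets_mono' Un_mono UN_mono generated_events_mono) auto

lemma past_initial: "{\<omega> \<in> space M. P (\<zeta> 0 \<omega>)} \<in> past s"
  unfolding past_def using generated_eventsI[of 0 "{0}" M P \<zeta>] by auto

lemma past_clock: "e \<in> K \<Longrightarrow> 0 \<le> u \<Longrightarrow> u \<le> s \<Longrightarrow> {\<omega> \<in> space M. P (N e u \<omega>)} \<in> past s"
  unfolding past_def using generated_eventsI[of u "{0..s}" M P "N e"] by auto

lemma past_increment:
  assumes "e \<in> K" "0 \<le> s" "s \<le> t"
  shows "{\<omega> \<in> space M. N e t \<omega> - N e s \<omega> = k} \<in> past t"
proof -
  interpret P: sigma_algebra "space M" "past t" by (rule sigma_algebra_past)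
  have "{\<omega> \<in> space M. N e t \<omega> - N e s \<omega> = k}
    = (\<Union>i. \<Union>j\<in>{j. i - j = k}. {\<omega> \<in> space M. N e t \<omega> = i} \<inter> {\<omega> \<in> space M. N e s \<omega> = j})"
    by auto
  also have "\<dots> \<in> past t"
    using assms by (intro P.countable_UN'' P.Int past_clock) auto
  finally show ?thesis .
qed

lemma past_increments_are:
  assumes "0 \<le> s" "s \<le> t"
  shows "increments_are s t c \<in> past t"
proof -
  interpret P: sigma_algebra "space M" "past t" by (rule sigma_algebra_past)
  show ?thesis
    unfolding increments_are_def
    by (rule P.sets_Collect_finite_All) (use past_increment[OF _ assms] finite_edges in auto)
qed

text \<open>Each clock is split into its path up to \<open>s\<close> and its later increment.
  Independence across clocks and of increments within a clock make all these pieces jointly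
  independent; grouping them gives independence of the past sigma-algebra from the joint increments,
  whose law is a product of Poisson weights.\<close>

lemma past_future_independent:
  assumes A: "A \<in> past s" and "0 \<le> s" "s < t"
  shows "prob (A \<inter> increments_are s t c)
    = prob A * (\<Prod>e\<in>K. (t - s) ^ c e / fact (c e) * exp (- (t - s)))"
proof -
  let ?gi = "\<lambda>e. generated_events M {t} (\<lambda>t \<omega>. N e t \<omega> - N e s \<omega>)"
  let ?gp = "\<lambda>e. generated_events M {0..s} (N e)"
  \<comment> \<open>\<open>Inl None\<close> is the initial configuration,
    \<open>Inl (Some e)\<close> the clock of \<open>e\<close> up to \<open>s\<close>, and
    \<open>Inr e\<close> its increment.\<close>
  define H :: "('x \<times> 'x) option + ('x \<times> 'x) \<Rightarrow> 'w set set" where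
    "H j = (case j of Inl None \<Rightarrow> generated_events M {0} \<zeta> | Inl (Some e) \<Rightarrow> ?gp e | Inr e \<Rightarrow> ?gi e)" for j
  let ?O = "insert None (Some ` K)"
  have fO: "finite ?O" using finite_edges by simp
  have gi: "?gi e \<subseteq> generated_events M {0..} (N e)" for e
    using assms by (intro increment_events_subset) auto
  have gp: "?gp e \<subseteq> generated_events M {0..} (N e)" for e
    by (rule generated_events_mono) auto
  have ev: "H j \<subseteq> events" if "j \<in> ?O <+> K" for j
  proof -
    have "?gi e \<subseteq> events" "?gp e \<subseteq> events" if "e \<in> K" for e
      using gi[of e] gp[of e] generated_events_in_events(2)[OF that] by blast+
    then show ?thesis
      using that generated_events_in_events(1)
      by (elim PlusE insertE imageE) (simp_all add: H_def)
  qed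
  \<comment> \<open>With the whole space in every family, independence has to be tested only on the
    full finite index set.\<close>
  have top: "space M \<in> H j" for j
    unfolding H_def generated_events_def by (auto split: option.split sum.split intro: sigma_sets_top)
  have indH: "indep_sets H (?O <+> K)"
  proof -
    have "\<forall>A\<in>Pi (?O <+> K) H. prob (\<Inter>j\<in>?O <+> K. A j) = (\<Prod>j\<in>?O <+> K. prob (A j))"
    proof
      fix A assume "A \<in> Pi (?O <+> K) H"
      then have mem: "A j \<in> H j" if "j \<in> ?O <+> K" for j using that by (rule Pi_mem)
      have A: "A (Inl None) \<in> generated_events M {0} \<zeta>"
          "\<And>e. e \<in> K \<Longrightarrow> A (Inl (Some e)) \<in> ?gp e" "\<And>e. e \<in> K \<Longrightarrow> A (Inr e) \<in> ?gi e"
        using mem[of "Inl None"] mem[of "Inl (Some _)"] mem[of "Inr _"] by (simp_all add: H_def InlI InrI)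
      \<comment> \<open>Merges the two pieces of each clock into one event, so that independence of
        different clocks applies; the merged events are factored afterwards.\<close>
      define B where "B i = (case i of None \<Rightarrow> A (Inl None) | Some e \<Rightarrow> A (Inl (Some e)) \<inter> A (Inr e))" for i
      have "(\<Inter>j\<in>?O <+> K. A j) = (\<Inter>i\<in>?O. B i)"
        unfolding Plus_def INT_Un by (simp add: B_def INT_Int_distrib Int_assoc)
      also have "prob \<dots> = (\<Prod>i\<in>?O. prob (B i))"
      proof (rule indep_setsD[OF clock_independent])
        have "A (Inl (Some e)) \<inter> A (Inr e) \<in> generated_events M {0..} (N e)" if "e \<in> K" for e
        proof -
          interpret G: sigma_algebra "space M" "generated_events M {0..} (N e)"
            by (rule sigma_algebra_generated_events)
          show ?thesis using A that gi gp by blast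
        qed
        then show "\<forall>i\<in>?O. B i \<in> (case i of None \<Rightarrow> generated_events M {0} \<zeta>
          | Some e \<Rightarrow> generated_events M {0..} (N e))"
          using A by (auto simp: B_def)
      qed (use fO in auto)
      also have "\<dots> = prob (A (Inl None)) * (\<Prod>e\<in>K. prob (A (Inl (Some e)) \<inter> A (Inr e)))"
        using finite_edges by (subst prod.insert) (auto simp: B_def prod.reindex)
      also have "(\<Prod>e\<in>K. prob (A (Inl (Some e)) \<inter> A (Inr e)))
        = (\<Prod>e\<in>K. prob (A (Inl (Some e))) * prob (A (Inr e)))"
      proof (rule prod.cong)
        fix e assume e: "e \<in> K"
        have "indep_set (?gp e) (?gi e)"
          using clocks[OF e] assms by (auto simp: poisson_process_def)
        then show "prob (A (Inl (Some e)) \<inter> A (Inr e)) = prob (A (Inl (Some e))) * prob (A (Inr e))"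
          by (rule indep_setD[OF _ A(2)[OF e] A(3)[OF e]])
      qed simp
      also have "prob (A (Inl None)) * \<dots> = (\<Prod>i\<in>?O. prob (A (Inl i))) * (\<Prod>e\<in>K. prob (A (Inr e)))"
      proof -
        have "(\<Prod>i\<in>?O. prob (A (Inl i))) = prob (A (Inl None)) * (\<Prod>e\<in>K. prob (A (Inl (Some e))))"
          using finite_edges by (subst prod.insert) (auto simp: prod.reindex)
        then show ?thesis by (simp add: prod.distrib mult.assoc)
      qed
      also have "\<dots> = (\<Prod>j\<in>?O <+> K. prob (A j))"
        using prod.Plus[OF fO finite_edges, of "\<lambda>j. prob (A j)"] by (simp only: comp_def)
      finally show "prob (\<Inter>j\<in>?O <+> K. A j) = (\<Prod>j\<in>?O <+> K. prob (A j))" .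
    qed
    then show ?thesis
      using finite_edges by (intro indep_sets_finite[THEN iffD2, OF _ _ ev top]) auto
  qed
  define D where "D e = {\<omega> \<in> space M. N e t \<omega> - N e s \<omega> = c e}" for e
  have D: "D e \<in> ?gi e" for e
    unfolding D_def using generated_eventsI[of t "{t}" M "\<lambda>k. k = c e"] by simp
  \<comment> \<open>\<open>False\<close> collects the pieces of the past, \<open>True\<close> the
    increments.\<close>
  define I where "I b = (if b then Inr ` K else Inl ` ?O)" for b
  define R where "R = sigma_sets (space M) (\<Union>i\<in>I True. H i)"
  have ind: "indep_sets (\<lambda>b. sigma_sets (space M) (\<Union>i\<in>I b. H i)) UNIV"
  proof (rule indep_sets_collect_sigma)
    have "(\<Union>b\<in>UNIV. I b) = ?O <+> K" by (auto simp: I_def UNIV_bool Plus_def)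
    then show "indep_sets H (\<Union>b\<in>UNIV. I b)" using indH by simp
    show "Int_stable (H i)" for i
      unfolding H_def by (auto simp: Int_stable_generated_events split: option.split sum.split)
    show "disjoint_family_on I UNIV" by (auto simp: disjoint_family_on_def I_def)
  qed
  have past: "sigma_sets (space M) (\<Union>i\<in>I False. H i) = past s"
    by (simp add: past_def I_def H_def)
  have "increments_are s t c \<in> R"
  proof -
    have "(\<Union>i\<in>I True. H i) \<subseteq> Pow (space M)"
    proof (rule UN_least)
      fix i assume "i \<in> I True"
      then have "i \<in> ?O <+> K" by (auto simp: I_def)
      then show "H i \<subseteq> Pow (space M)" by (rule subset_trans[OF ev sets.space_closed])
    qed
    then interpret R: sigma_algebra "space M" R
      unfolding R_def by (rule sigma_algebra_sigma_sets)
    show ?thesis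
      unfolding increments_are_def
    proof (rule R.sets_Collect_finite_All)
      fix e assume "e \<in> K"
      then show "{\<omega> \<in> space M. N e t \<omega> - N e s \<omega> = c e} \<in> R"
        using D[of e] unfolding D_def R_def
        by (intro sigma_sets.Basic UN_I[of "Inr e"]) (simp_all add: I_def H_def)
    qed (rule finite_edges)
  qed
  moreover from ind past have "indep_set R (past s)"
    unfolding indep_set_def
    by (elim indep_sets_mono_sets) (simp add: R_def split: bool.split)
  ultimately have "prob (A \<inter> increments_are s t c) = prob A * prob (increments_are s t c)"
    using indep_setD[of R "past s" "increments_are s t c" A] A by (simp add: Int_commute)
  also have "prob (increments_are s t c) = (\<Prod>e\<in>K. prob (D e))"
  \<comment> \<open>Without edges the intersection over \<open>K\<close> would be the whole type
    instead of \<open>space M\<close>.\<close>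
  proof (cases "K = {}")
    case True
    then show ?thesis by (simp add: increments_are_def prob_space)
  next
    case False
    let ?J = "Inr ` K :: (('x \<times> 'x) option + ('x \<times> 'x)) set"
    have "prob (\<Inter>j\<in>?J. D (projr j)) = (\<Prod>j\<in>?J. prob (D (projr j)))"
    proof (rule indep_setsD[OF indH])
      show "\<forall>j\<in>?J. D (projr j) \<in> H j" using D by (simp add: H_def)
    qed (use False finite_edges in auto)
    moreover have "increments_are s t c = (\<Inter>e\<in>K. D e)"
      unfolding increments_are_def D_def using False by blast
    ultimately show ?thesis by (simp add: prod.reindex)
  qed
  also have "\<dots> = (\<Prod>e\<in>K. (t - s) ^ c e / fact (c e) * exp (- (t - s)))"
  proof (rule prod.cong[OF refl])
    fix e assume "e \<in> K"
    then show "prob (D e) = (t - s) ^ c e / fact (c e) * exp (- (t - s))"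
      unfolding D_def using assms(2,3) by (rule increment_prob)
  qed
  finally show ?thesis .
qed

section \<open>Discretisation of time\<close>

definition single_activation :: "real \<Rightarrow> nat \<Rightarrow> 'x \<times> 'x \<Rightarrow> 'w set" where
  "single_activation h k e = increments_are (real k * h) (real (Suc k) * h) (\<lambda>e'. of_bool (e' = e))"

definition no_activation :: "real \<Rightarrow> nat \<Rightarrow> 'w set" where
  "no_activation h k = increments_are (real k * h) (real (Suc k) * h) (\<lambda>_. 0)"

text \<open>
  The process observed at the multiples of \<open>h\<close>, where time slots with two or more activations
  are ignored; these have a total probability of order \<open>h\<close> over a bounded time interval.
\<close>

primrec chain :: "real \<Rightarrow> nat \<Rightarrow> 'w \<Rightarrow> 'x \<Rightarrow> nat list" where
  "chain h 0 \<omega> = \<zeta> 0 \<omega>"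
| "chain h (Suc k) \<omega> = (if \<exists>e\<in>K. \<omega> \<in> single_activation h k e
     then move \<tau> (chain h k \<omega>) (SOME e. e \<in> K \<and> \<omega> \<in> single_activation h k e) else chain h k \<omega>)"

text \<open>Makes the \<open>SOME\<close> in \<open>chain\<close> determinate: the increment of
  \<open>e\<close> is one, which \<open>single_activation h k e'\<close> permits only for
  \<open>e' = e\<close>.\<close>

lemma single_activation_unique:
  assumes "e \<in> K" "\<omega> \<in> single_activation h k e" "\<omega> \<in> single_activation h k e'"
  shows "e = e'"
proof -
  have "N e (real (Suc k) * h) \<omega> - N e (real k * h) \<omega> = of_bool (e = e)"
    "N e (real (Suc k) * h) \<omega> - N e (real k * h) \<omega> = of_bool (e = e')"
    using assms unfolding single_activation_def increments_are_def by blast+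
  then show ?thesis by (cases "e = e'") auto
qed

lemma no_activation_disjoint: "e \<in> K \<Longrightarrow> no_activation h k \<inter> single_activation h k e = {}"
  unfolding single_activation_def no_activation_def increments_are_def by force

lemma chain_single:
  assumes "e \<in> K" "\<omega> \<in> single_activation h k e"
  shows "chain h (Suc k) \<omega> = move \<tau> (chain h k \<omega>) e"
proof -
  have "(SOME e. e \<in> K \<and> \<omega> \<in> single_activation h k e) = e"
    using assms single_activation_unique by (intro some_equality) blast+
  then show ?thesis using assms by auto
qed

lemma chain_not_single:
  "(\<And>e. e \<in> K \<Longrightarrow> \<omega> \<notin> single_activation h k e) \<Longrightarrow> chain h (Suc k) \<omega> = chain h k \<omega>"
  by auto

lemma chain_in_states: "\<omega> \<in> space M \<Longrightarrow> chain h k \<omega> \<in> \<Omega>"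
proof (induction k)
  case 0
  then show ?case using state_in[of 0 \<omega>] by simp
next
  case (Suc k)
  show ?case
  proof (cases "\<exists>e\<in>K. \<omega> \<in> single_activation h k e")
    case True
    then obtain e where e: "e \<in> K" "\<omega> \<in> single_activation h k e" by blast
    then have "e \<in> S \<times> S" using edges_subset by blast
    then show ?thesis using chain_single[OF e] move_in_states Suc by metis
  next
    case False
    then show ?thesis using Suc chain_not_single[of \<omega> h k] by metis
  qed
qed

text \<open>Every slot event appears here intersected with an event decided before the slot, which
  prepares the use of independence. Idle and crowded slots are covered together by
  subtraction.\<close>

lemma chain_event_Suc:
  "{\<omega> \<in> space M. P (chain h (Suc k) \<omega>)}
    = (\<Union>e\<in>K. {\<omega> \<in> space M. P (move \<tau> (chain h k \<omega>) e)} \<inter> single_activation h k e) \<union>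
      ({\<omega> \<in> space M. P (chain h k \<omega>)}
        - (\<Union>e\<in>K. {\<omega> \<in> space M. P (chain h k \<omega>)} \<inter> single_activation h k e))" (is "?L = ?R")
proof (rule set_eqI)
  fix \<omega>
  show "\<omega> \<in> ?L \<longleftrightarrow> \<omega> \<in> ?R"
  proof (cases "\<exists>e\<in>K. \<omega> \<in> single_activation h k e")
    case True
    then obtain e where e: "e \<in> K" "\<omega> \<in> single_activation h k e" by blast
    then have "\<omega> \<in> single_activation h k e' \<longleftrightarrow> e' = e" if "e' \<in> K" for e'
      using single_activation_unique that by blast
    then show ?thesis using e chain_single[OF e] by auto
  next
    case False
    then show ?thesis using chain_not_single[of \<omega> h k] by auto
  qed
qed

lemma single_activation_past: "0 \<le> h \<Longrightarrow> single_activation h k e \<in> past (real (Suc k) * h)"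
  unfolding single_activation_def by (intro past_increments_are mult_right_mono) auto

lemma no_activation_past: "0 \<le> h \<Longrightarrow> no_activation h k \<in> past (real (Suc k) * h)"
  unfolding no_activation_def by (intro past_increments_are mult_right_mono) auto

lemma activation_events:
  assumes "0 \<le> h"
  shows "single_activation h k e \<in> events" "no_activation h k \<in> events"
  using single_activation_past[OF assms] no_activation_past[OF assms] past_in_events by blast+

text \<open>The predicate is generalised in the induction because a move along \<open>e\<close> is
  absorbed into it.\<close>

lemma chain_past:
  assumes "0 \<le> h"
  shows "{\<omega> \<in> space M. P (chain h k \<omega>)} \<in> past (real k * h)"
proof (induction k arbitrary: P)
  case 0
  then show ?case using past_initial by simp
next
  case (Suc k)
  interpret P: sigma_algebra "space M" "past (real (Suc k) * h)" by (rule sigma_algebra_past)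
  have "real k * h \<le> real (Suc k) * h" using assms by (intro mult_right_mono) auto
  then have IH: "{\<omega> \<in> space M. P (chain h k \<omega>)} \<in> past (real (Suc k) * h)" for P
    using Suc.IH past_mono by blast
  show ?case
    unfolding chain_event_Suc
    by (intro P.Un P.Diff P.finite_UN P.Int IH single_activation_past assms finite_edges)
qed

text \<open>The probability \<open>h * exp (- h)\<close> that a given clock rings exactly once in a
  slot, times \<open>exp (- h)\<close> for each other clock.\<close>

definition jump_prob :: "real \<Rightarrow> real" where
  "jump_prob h = h * exp (- (real (card K) * h))"

lemma slot_length: "real (Suc k) * h - real k * h = h"
  by (simp add: algebra_simps)

lemma prob_Int_single_activation:
  assumes "A \<in> past (real k * h)" "0 < h" "e \<in> K"
  shows "prob (A \<inter> single_activation h k e) = prob A * jump_prob h"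
proof -
  have "prob (A \<inter> single_activation h k e)
      = prob A * (\<Prod>e'\<in>K. h ^ of_bool (e' = e) / fact (of_bool (e' = e)) * exp (- h))"
    unfolding single_activation_def
    using past_future_independent[of A "real k * h" "real (Suc k) * h"] assms
    by (simp only: slot_length) simp
  also have "(\<Prod>e'\<in>K. h ^ of_bool (e' = e) / fact (of_bool (e' = e)) * exp (- h))
      = (\<Prod>e'\<in>K. (if e' = e then h else 1) * exp (- h))"
    by (intro prod.cong) auto
  also have "\<dots> = h * exp (- h) ^ card K"
    using assms finite_edges by (simp add: prod.distrib)
  also have "\<dots> = jump_prob h"
    by (simp add: jump_prob_def exp_of_nat_mult[symmetric])
  finally show ?thesis .
qed

lemma space_past: "space M \<in> past s"
  using sigma_algebra.sigma_sets_eq[OF sigma_algebra_past] sigma_sets_top by blast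

lemma prob_no_activation:
  assumes "0 < h"
  shows "prob (no_activation h k) = exp (- (real (card K) * h))"
proof -
  have "no_activation h k = space M \<inter> no_activation h k"
    by (auto simp: no_activation_def increments_are_def)
  then have "prob (no_activation h k) = prob (space M \<inter> no_activation h k)" by simp
  also have "\<dots> = prob (space M) * (\<Prod>e\<in>K. exp (- h))"
    unfolding no_activation_def
    using past_future_independent[OF space_past, of "real k * h" "real (Suc k) * h" "\<lambda>_. 0"] assms
    by (simp only: slot_length) simp
  also have "\<dots> = exp (- (real (card K) * h))"
    by (simp add: prob_space exp_of_nat_mult[symmetric])
  finally show ?thesis .
qed

text \<open>The number of activations in a slot is Poisson with mean \<open>d = card K * h\<close>.
  It is at least two with probability \<open>1 - (1 + d) * exp (- d)\<close>, and
  \<open>exp (- d) \<ge> 1 - d\<close> bounds this by \<open>d^2\<close>.\<close>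

lemma prob_many_activations_le:
  assumes "0 < h"
  shows "prob (space M - (no_activation h k \<union> (\<Union>e\<in>K. single_activation h k e))) \<le> (real (card K) * h)\<^sup>2"
proof -
  let ?d = "real (card K) * h"
  have ev: "single_activation h k e \<in> events" "no_activation h k \<in> events" for e
    using activation_events assms by simp_all
  have "prob (single_activation h k e) = jump_prob h" if "e \<in> K" for e
  proof -
    have "space M \<inter> single_activation h k e = single_activation h k e"
      by (auto simp: single_activation_def increments_are_def)
    then show ?thesis
      using prob_Int_single_activation[OF space_past assms that, of k] by (simp add: prob_space)
  qed
  moreover have "prob (\<Union>e\<in>K. single_activation h k e) = (\<Sum>e\<in>K. prob (single_activation h k e))"
  proof (rule finite_measure_finite_Union[OF finite_edges])
    show "disjoint_family_on (single_activation h k) K"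
      unfolding disjoint_family_on_def using single_activation_unique by blast
  qed (use ev in auto)
  ultimately have "prob (\<Union>e\<in>K. single_activation h k e) = ?d * exp (- ?d)"
    by (simp add: jump_prob_def)
  moreover have "prob (no_activation h k \<union> (\<Union>e\<in>K. single_activation h k e))
      = prob (no_activation h k) + prob (\<Union>e\<in>K. single_activation h k e)"
    using ev no_activation_disjoint finite_edges by (intro finite_measure_Union sets.finite_UN) blast+
  ultimately have "prob (no_activation h k \<union> (\<Union>e\<in>K. single_activation h k e)) = (1 + ?d) * exp (- ?d)"
    using prob_no_activation[OF assms] by (simp add: algebra_simps)
  moreover have "no_activation h k \<union> (\<Union>e\<in>K. single_activation h k e) \<in> events"
    using ev finite_edges by (intro sets.Un sets.finite_UN) auto
  ultimately have "prob (space M - (no_activation h k \<union> (\<Union>e\<in>K. single_activation h k e)))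
      = 1 - (1 + ?d) * exp (- ?d)"
    by (simp add: prob_compl)
  moreover have "(1 + ?d) * (1 - ?d) \<le> (1 + ?d) * exp (- ?d)"
    using exp_ge_add_one_self[of "- ?d"] assms by (intro mult_left_mono) auto
  moreover have "(1 + ?d) * (1 - ?d) = 1 - ?d\<^sup>2" by (simp add: power2_eq_square algebra_simps)
  ultimately show ?thesis by linarith
qed

lemma chain_event: "0 \<le> h \<Longrightarrow> {\<omega> \<in> space M. P (chain h k \<omega>)} \<in> events"
  using chain_past past_in_events by blast

text \<open>Forward equation of the slot chain: the state before the slot is independent of what
  happens in it, and each edge is selected with probability \<open>jump_prob h\<close>.\<close>

lemma prob_chain_Suc:
  assumes "0 < h"
  shows "prob {\<omega> \<in> space M. P (chain h (Suc k) \<omega>)} = prob {\<omega> \<in> space M. P (chain h k \<omega>)} +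
    jump_prob h * (\<Sum>e\<in>K. prob {\<omega> \<in> space M. P (move \<tau> (chain h k \<omega>) e)}
      - prob {\<omega> \<in> space M. P (chain h k \<omega>)})"
proof -
  define A where "A = single_activation h k"
  define B where "B = {\<omega> \<in> space M. P (chain h k \<omega>)}"
  define C where "C e = {\<omega> \<in> space M. P (move \<tau> (chain h k \<omega>) e)}" for e
  have ev: "A e \<in> events" "B \<in> events" "C e \<in> events" for e
    unfolding A_def B_def C_def
    using activation_events chain_event[of h _ k] assms by simp_all
  have indep: "prob (C e \<inter> A e) = prob (C e) * jump_prob h" "prob (B \<inter> A e) = prob B * jump_prob h"
    if "e \<in> K" for e
    unfolding A_def B_def C_def
    using assms that by (intro prob_Int_single_activation chain_past; simp)+
  have disj: "disjoint_family_on (\<lambda>e. D e \<inter> A e) K" for D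
    unfolding disjoint_family_on_def A_def using single_activation_unique by blast
  have union: "prob (\<Union>e\<in>K. D e \<inter> A e) = (\<Sum>e\<in>K. prob (D e \<inter> A e))" if "\<And>e. D e \<in> events" for D
    using ev that by (intro finite_measure_finite_Union[OF finite_edges _ disj]) auto
  have Bsub: "(\<Union>e\<in>K. B \<inter> A e) \<in> events" "(\<Union>e\<in>K. C e \<inter> A e) \<in> events"
    using ev finite_edges by (auto intro!: sets.finite_UN)
  have "(\<Union>e\<in>K. C e \<inter> A e) \<inter> (B - (\<Union>e\<in>K. B \<inter> A e)) = {}" by blast
  then have "prob ((\<Union>e\<in>K. C e \<inter> A e) \<union> (B - (\<Union>e\<in>K. B \<inter> A e)))
      = prob (\<Union>e\<in>K. C e \<inter> A e) + prob (B - (\<Union>e\<in>K. B \<inter> A e))"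
    using Bsub ev(2) by (intro finite_measure_Union sets.Diff)
  also have "prob (B - (\<Union>e\<in>K. B \<inter> A e)) = prob B - prob (\<Union>e\<in>K. B \<inter> A e)"
    using Bsub ev(2) by (intro finite_measure_Diff) auto
  also have "prob (\<Union>e\<in>K. C e \<inter> A e) = (\<Sum>e\<in>K. prob (C e) * jump_prob h)"
    using union[OF ev(3)] indep(1) by simp
  also have "prob (\<Union>e\<in>K. B \<inter> A e) = (\<Sum>e\<in>K. prob B * jump_prob h)"
    using union[OF ev(2)] indep(2) by simp
  also have "(\<Sum>e\<in>K. prob (C e) * jump_prob h) + (prob B - (\<Sum>e\<in>K. prob B * jump_prob h))
      = prob B + jump_prob h * (\<Sum>e\<in>K. prob (C e) - prob B)"
    by (simp add: sum_subtractf sum_distrib_left algebra_simps)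
  finally show ?thesis
    unfolding chain_event_Suc A_def B_def C_def .
qed

lemma prob_chain_sum:
  assumes "0 \<le> h"
  shows "prob {\<omega> \<in> space M. P (chain h k \<omega>)}
    = (\<Sum>\<sigma>\<in>\<Omega>. of_bool (P \<sigma>) * prob {\<omega> \<in> space M. chain h k \<omega> = \<sigma>})"
proof -
  have "{\<omega> \<in> space M. P (chain h k \<omega>)} = (\<Union>\<sigma>\<in>{\<sigma> \<in> \<Omega>. P \<sigma>}. {\<omega> \<in> space M. chain h k \<omega> = \<sigma>})"
    using chain_in_states by blast
  also have "prob \<dots> = (\<Sum>\<sigma>\<in>{\<sigma> \<in> \<Omega>. P \<sigma>}. prob {\<omega> \<in> space M. chain h k \<omega> = \<sigma>})"
    using finite_states chain_event[OF assms]
    by (intro finite_measure_finite_Union) (auto simp: disjoint_family_on_def)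
  also have "\<dots> = (\<Sum>\<sigma>\<in>\<Omega>. of_bool (P \<sigma>) * prob {\<omega> \<in> space M. chain h k \<omega> = \<sigma>})"
    unfolding sum.inter_filter[OF finite_states] by (intro sum.cong) auto
  finally show ?thesis .
qed

text \<open>Turns the forward equation for events into its dual form for test functions, by
  summation against \<open>\<phi>\<close> and a change of variables along
  \<open>move\<close>.\<close>

lemma jump_chain_chain:
  assumes "0 < h"
  shows "jump_chain \<Omega> K (move \<tau>) (\<lambda>k \<sigma>. prob {\<omega> \<in> space M. chain h k \<omega> = \<sigma>}) (jump_prob h)"
proof
  show "0 \<le> jump_prob h" using assms by (simp add: jump_prob_def)
  show "(\<Sum>\<sigma>\<in>\<Omega>. prob {\<omega> \<in> space M. chain h k \<omega> = \<sigma>}) = 1" for k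
    using prob_chain_sum[of h "\<lambda>_. True" k] assms by (simp add: prob_space)
next
  fix \<phi> :: "('x \<Rightarrow> nat list) \<Rightarrow> real" and k
  let ?q = "\<lambda>\<sigma>. prob {\<omega> \<in> space M. chain h k \<omega> = \<sigma>}"
  let ?p = "jump_prob h"
  have pushforward: "(\<Sum>\<sigma>\<in>\<Omega>. \<phi> \<sigma> * prob {\<omega> \<in> space M. move \<tau> (chain h k \<omega>) e = \<sigma>})
      = (\<Sum>\<sigma>\<in>\<Omega>. \<phi> (move \<tau> \<sigma> e) * ?q \<sigma>)" if "e \<in> K" for e
  proof -
    have "(\<Sum>\<sigma>\<in>\<Omega>. \<phi> \<sigma> * prob {\<omega> \<in> space M. move \<tau> (chain h k \<omega>) e = \<sigma>})
        = (\<Sum>\<sigma>\<in>\<Omega>. \<phi> \<sigma> * (\<Sum>\<sigma>'\<in>\<Omega>. of_bool (move \<tau> \<sigma>' e = \<sigma>) * ?q \<sigma>'))"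
      using prob_chain_sum[of h "\<lambda>\<sigma>'. move \<tau> \<sigma>' e = _" k] assms by simp
    also have "\<dots> = (\<Sum>\<sigma>'\<in>\<Omega>. \<Sum>\<sigma>\<in>\<Omega>. \<phi> \<sigma> * (of_bool (move \<tau> \<sigma>' e = \<sigma>) * ?q \<sigma>'))"
      unfolding sum_distrib_left by (rule sum.swap)
    also have "\<dots> = (\<Sum>\<sigma>'\<in>\<Omega>. \<Sum>\<sigma>\<in>\<Omega>. if move \<tau> \<sigma>' e = \<sigma> then \<phi> \<sigma> * ?q \<sigma>' else 0)"
      by (intro sum.cong refl) auto
    also have "\<dots> = (\<Sum>\<sigma>'\<in>\<Omega>. \<phi> (move \<tau> \<sigma>' e) * ?q \<sigma>')"
    proof (rule sum.cong[OF refl])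
      fix \<sigma>' assume "\<sigma>' \<in> \<Omega>"
      then have "move \<tau> \<sigma>' e \<in> \<Omega>" using edges_subset that by (intro move_in_states) auto
      then show "(\<Sum>\<sigma>\<in>\<Omega>. if move \<tau> \<sigma>' e = \<sigma> then \<phi> \<sigma> * ?q \<sigma>' else 0) = \<phi> (move \<tau> \<sigma>' e) * ?q \<sigma>'"
        using finite_states by (simp add: sum.delta)
    qed
    finally show ?thesis .
  qed
  \<comment> \<open>Used twice: to bring the sum over states inside the sum over edges, and to take
    it out again after the change of variables.\<close>
  have swap: "(\<Sum>\<sigma>\<in>\<Omega>. a \<sigma> + (\<Sum>e\<in>K. ?p * (b \<sigma> e - a \<sigma>)))
      = (\<Sum>\<sigma>\<in>\<Omega>. a \<sigma>) + (\<Sum>e\<in>K. ?p * ((\<Sum>\<sigma>\<in>\<Omega>. b \<sigma> e) - (\<Sum>\<sigma>\<in>\<Omega>. a \<sigma>)))" for a b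
  proof -
    have "(\<Sum>\<sigma>\<in>\<Omega>. \<Sum>e\<in>K. ?p * (b \<sigma> e - a \<sigma>)) = (\<Sum>e\<in>K. \<Sum>\<sigma>\<in>\<Omega>. ?p * (b \<sigma> e - a \<sigma>))"
      by (rule sum.swap)
    also have "\<dots> = (\<Sum>e\<in>K. ?p * ((\<Sum>\<sigma>\<in>\<Omega>. b \<sigma> e) - (\<Sum>\<sigma>\<in>\<Omega>. a \<sigma>)))"
      by (simp only: sum_distrib_left[symmetric] sum_subtractf)
    finally show ?thesis by (simp only: sum.distrib)
  qed
  have "(\<Sum>\<sigma>\<in>\<Omega>. \<phi> \<sigma> * prob {\<omega> \<in> space M. chain h (Suc k) \<omega> = \<sigma>})
      = (\<Sum>\<sigma>\<in>\<Omega>. \<phi> \<sigma> * ?q \<sigma> + (\<Sum>e\<in>K. ?p * (\<phi> \<sigma> * prob {\<omega> \<in> space M. move \<tau> (chain h k \<omega>) e = \<sigma>}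
          - \<phi> \<sigma> * ?q \<sigma>)))"
  proof (rule sum.cong[OF refl])
    fix \<sigma>
    show "\<phi> \<sigma> * prob {\<omega> \<in> space M. chain h (Suc k) \<omega> = \<sigma>} = \<phi> \<sigma> * ?q \<sigma> +
        (\<Sum>e\<in>K. ?p * (\<phi> \<sigma> * prob {\<omega> \<in> space M. move \<tau> (chain h k \<omega>) e = \<sigma>} - \<phi> \<sigma> * ?q \<sigma>))"
      unfolding prob_chain_Suc[OF assms, of "\<lambda>\<sigma>'. \<sigma>' = \<sigma>"]
      by (simp add: algebra_simps sum_distrib_left sum_subtractf)
  qed
  also have "\<dots> = (\<Sum>\<sigma>\<in>\<Omega>. \<phi> \<sigma> * ?q \<sigma>) + (\<Sum>e\<in>K. ?p *
      ((\<Sum>\<sigma>\<in>\<Omega>. \<phi> \<sigma> * prob {\<omega> \<in> space M. move \<tau> (chain h k \<omega>) e = \<sigma>}) - (\<Sum>\<sigma>\<in>\<Omega>. \<phi> \<sigma> * ?q \<sigma>)))"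
    by (rule swap)
  also have "\<dots> = (\<Sum>\<sigma>\<in>\<Omega>. \<phi> \<sigma> * ?q \<sigma>) + (\<Sum>e\<in>K. ?p *
      ((\<Sum>\<sigma>\<in>\<Omega>. \<phi> (move \<tau> \<sigma> e) * ?q \<sigma>) - (\<Sum>\<sigma>\<in>\<Omega>. \<phi> \<sigma> * ?q \<sigma>)))"
    using pushforward by simp
  also have "\<dots> = (\<Sum>\<sigma>\<in>\<Omega>. \<phi> \<sigma> * ?q \<sigma> + (\<Sum>e\<in>K. ?p * (\<phi> (move \<tau> \<sigma> e) * ?q \<sigma> - \<phi> \<sigma> * ?q \<sigma>)))"
    by (rule swap[symmetric])
  also have "\<dots> = (\<Sum>\<sigma>\<in>\<Omega>. (\<phi> \<sigma> + ?p * (\<Sum>e\<in>K. \<phi> (move \<tau> \<sigma> e) - \<phi> \<sigma>)) * ?q \<sigma>)"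
    by (intro sum.cong refl)
      (simp add: distrib_right sum_distrib_left sum_distrib_right left_diff_distrib right_diff_distrib mult.assoc)
  finally show "(\<Sum>\<sigma>\<in>\<Omega>. \<phi> \<sigma> * prob {\<omega> \<in> space M. chain h (Suc k) \<omega> = \<sigma>})
      = (\<Sum>\<sigma>\<in>\<Omega>. (\<phi> \<sigma> + ?p * (\<Sum>e\<in>K. \<phi> (move \<tau> \<sigma> e) - \<phi> \<sigma>)) * ?q \<sigma>)" .
qed auto

section \<open>Consensus\<close>

text \<open>The uniform law on a singleton is a point mass, and the countably many exceptional null
  sets may be combined.\<close>

lemma AE_choices:
  "AE \<omega> in M. \<forall>e\<in>K. \<forall>k. \<forall>a\<in>V. \<forall>b\<in>V. a \<noteq> b \<longrightarrow> U e k a b \<omega> = step_toward a b"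
proof -
  have "AE \<omega> in M. a \<noteq> b \<longrightarrow> U e k a b \<omega> = step_toward a b"
    if "e \<in> K" "a \<in> V" "b \<in> V" for e k a b
  proof (cases "a = b")
    case False
    have eq: "distr M (count_space UNIV) (U e k a b) = measure_pmf (return_pmf (step_toward a b))"
      using choices_uniform[OF that False] closer_neighbours_tree[OF that(2,3) False]
      by (simp add: pmf_of_set_singleton)
    have "AE c in distr M (count_space UNIV) (U e k a b). c = step_toward a b"
      unfolding eq by (simp add: AE_measure_pmf_iff)
    then have "AE \<omega> in M. U e k a b \<omega> = step_toward a b"
      using choices_measurable[OF that False] by (rule AE_distrD[rotated])
    then show ?thesis by eventually_elim simp
  qed simp
  then show ?thesis
    using finite_edges finite_tree_vertices[of n r]
    by (simp add: AE_ball_countable AE_all_countable countable_finite)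
qed

lemma attract_eq_move:
  assumes \<sigma>: "\<sigma> \<in> \<Omega>" and e: "e \<in> K"
    and u: "\<And>a b. a \<in> V \<Longrightarrow> b \<in> V \<Longrightarrow> a \<noteq> b \<Longrightarrow> u a b = step_toward a b"
  shows "attract V (tree_edges n r) \<tau> \<sigma> e u = move \<tau> \<sigma> e"
proof -
  have v: "\<sigma> (fst e) \<in> V" "\<sigma> (snd e) \<in> V" using \<sigma> e edges_subset by force+
  then have "geodesic_dist V (tree_edges n r) (\<sigma> (fst e)) (\<sigma> (snd e)) = tree_dist (\<sigma> (fst e)) (\<sigma> (snd e))"
    by (rule geodesic_dist_tree)
  then show ?thesis
    using u[OF v] tree_dist_eq_0_iff[of "\<sigma> (fst e)" "\<sigma> (snd e)"]
    by (auto simp: attract_def move_def active_edge_def case_prod_beta)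
qed

lemma AE_jump_path: "AE \<omega> in M. jump_path K (\<lambda>t. \<zeta> t \<omega>) (\<lambda>e t. N e t \<omega>) (move \<tau>)"
  using AE_space AE_choices evolution
proof eventually_elim
  fix \<omega>
  assume \<omega>: "\<omega> \<in> space M"
    and U: "\<forall>e\<in>K. \<forall>k. \<forall>a\<in>V. \<forall>b\<in>V. a \<noteq> b \<longrightarrow> U e k a b \<omega> = step_toward a b"
    and ev: "\<forall>t>0. \<exists>\<eta>. (\<forall>\<^sub>F s in at_left t. \<zeta> s \<omega> = \<eta>) \<and>
         ((\<forall>e\<in>K. \<not> jumps_at (\<lambda>s. N e s \<omega>) t) \<longrightarrow> \<zeta> t \<omega> = \<eta>) \<and>
         (\<forall>e\<in>K. jumps_at (\<lambda>s. N e s \<omega>) t \<longrightarrow>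
            \<zeta> t \<omega> = attract V (tree_edges n r) \<tau> \<eta> e (\<lambda>a b. U e (N e t \<omega>) a b \<omega>))"
  show "jump_path K (\<lambda>t. \<zeta> t \<omega>) (\<lambda>e t. N e t \<omega>) (move \<tau>)"
  proof
    show "right_continuous_path (\<lambda>t. \<zeta> t \<omega>)" using right_continuous \<omega> by blast
    show "right_continuous_path (\<lambda>t. N e t \<omega>)" if "e \<in> K" for e
      using clocks[OF that] \<omega> by (auto simp: poisson_process_def)
    show "N e s \<omega> \<le> N e t \<omega>" if "e \<in> K" "0 \<le> s" "s \<le> t" for e s t
      using clock_mono that \<omega> by blast
  next
    fix t :: real assume t: "0 < t"
    then obtain \<eta> where left: "\<forall>\<^sub>F s in at_left t. \<zeta> s \<omega> = \<eta>"
      and idle: "(\<forall>e\<in>K. \<not> jumps_at (\<lambda>s. N e s \<omega>) t) \<longrightarrow> \<zeta> t \<omega> = \<eta>"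
      and act: "\<And>e. e \<in> K \<Longrightarrow> jumps_at (\<lambda>s. N e s \<omega>) t \<Longrightarrow>
        \<zeta> t \<omega> = attract V (tree_edges n r) \<tau> \<eta> e (\<lambda>a b. U e (N e t \<omega>) a b \<omega>)"
      using ev by blast
    \<comment> \<open>The left limit is a value of the process at some positive time, hence a legal
      configuration to which \<open>attract_eq_move\<close> applies.\<close>
    have "\<forall>\<^sub>F s in at_left t. 0 < s"
      using t by (auto simp: eventually_at_left_field)
    with left have "\<forall>\<^sub>F s in at_left t. \<eta> \<in> \<Omega>"
      by eventually_elim (use state_in \<omega> in force)
    then have "\<eta> \<in> \<Omega>" by simp
    then have "attract V (tree_edges n r) \<tau> \<eta> e (\<lambda>a b. U e (N e t \<omega>) a b \<omega>) = move \<tau> \<eta> e"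
      if "e \<in> K" for e
      using U that by (intro attract_eq_move) auto
    then show "\<exists>\<eta>. (\<forall>\<^sub>F s in at_left t. \<zeta> s \<omega> = \<eta>) \<and>
        ((\<forall>e\<in>K. \<not> jumps_at (\<lambda>s. N e s \<omega>) t) \<longrightarrow> \<zeta> t \<omega> = \<eta>) \<and>
        (\<forall>e\<in>K. jumps_at (\<lambda>s. N e s \<omega>) t \<longrightarrow> \<zeta> t \<omega> = move \<tau> \<eta> e)"
      using left idle act by metis
  qed
qed

text \<open>Induction over the slots: an idle slot changes neither side, and a single activation
  applies the same move to both.\<close>

lemma chain_eq_process:
  assumes "jump_path K (\<lambda>t. \<zeta> t \<omega>) (\<lambda>e t. N e t \<omega>) (move \<tau>)" "\<omega> \<in> space M" "0 \<le> h"
    and "\<And>k. k < m \<Longrightarrow> \<omega> \<in> no_activation h k \<union> (\<Union>e\<in>K. single_activation h k e)"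
  shows "\<zeta> (real m * h) \<omega> = chain h m \<omega>"
  using assms(4)
proof (induction m)
  case (Suc m)
  interpret jump_path K "\<lambda>t. \<zeta> t \<omega>" "\<lambda>e t. N e t \<omega>" "move \<tau>" by fact
  let ?s = "real m * h" and ?t = "real (Suc m) * h"
  have st: "0 \<le> ?s" "?s \<le> ?t" using \<open>0 \<le> h\<close> by (auto intro!: mult_right_mono)
  have IH: "\<zeta> ?s \<omega> = chain h m \<omega>" using Suc by simp
  have mono: "N e ?s \<omega> \<le> N e ?t \<omega>" if "e \<in> K" for e using N_mono[OF that st] .
  consider "\<omega> \<in> no_activation h m" | e where "e \<in> K" "\<omega> \<in> single_activation h m e"
    using Suc.prems[of m] by blast
  then show ?case
  proof cases
    case 1
    have "N e ?t \<omega> = N e ?s \<omega>" if "e \<in> K" for e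
    proof -
      have "N e ?t \<omega> - N e ?s \<omega> = 0"
        using 1 that unfolding no_activation_def increments_are_def by blast
      then show ?thesis using mono[OF that] by linarith
    qed
    then have "\<zeta> ?t \<omega> = \<zeta> ?s \<omega>" by (rule constant_if_no_events[OF st])
    moreover have "chain h (Suc m) \<omega> = chain h m \<omega>"
      using 1 no_activation_disjoint[of _ h m] by (intro chain_not_single) blast
    ultimately show ?thesis using IH by simp
  next
    case (2 e)
    have inc: "N e' ?t \<omega> - N e' ?s \<omega> = of_bool (e' = e)" if "e' \<in> K" for e'
      using 2(2) that unfolding single_activation_def increments_are_def by blast
    have "\<zeta> ?t \<omega> = move \<tau> (\<zeta> ?s \<omega>) e"
    proof (rule single_event[OF st 2(1)])
      have "N e ?t \<omega> - N e ?s \<omega> = 1" using inc[OF 2(1)] by simp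
      then show "N e ?t \<omega> = Suc (N e ?s \<omega>)" by linarith
      fix e' assume e': "e' \<in> K" "e' \<noteq> e"
      then have "N e' ?t \<omega> - N e' ?s \<omega> = 0" using inc[OF e'(1)] by simp
      then show "N e' ?t \<omega> = N e' ?s \<omega>" using mono[OF e'(1)] by linarith
    qed
    then show ?thesis using IH chain_single[OF 2] by metis
  qed
qed simp

text \<open>Equal opinions make every edge inactive, so consensus is absorbing.\<close>

lemma consensus_fixates:
  assumes "jump_path K (\<lambda>t. \<zeta> t \<omega>) (\<lambda>e t. N e t \<omega>) (move \<tau>)" "\<omega> \<in> space M" "0 \<le> t"
    and con: "consensus V S (\<zeta> t \<omega>)"
  shows "fixates_constant V S (\<lambda>t. \<zeta> t \<omega>)"
proof -
  interpret jump_path K "\<lambda>t. \<zeta> t \<omega>" "\<lambda>e t. N e t \<omega>" "move \<tau>" by fact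
  have "move \<tau> (\<zeta> t \<omega>) e = \<zeta> t \<omega>" if "e \<in> K" for e
  proof -
    have "fst e \<in> S" "snd e \<in> S" using edges_subset that by auto
    then have "\<zeta> t \<omega> (fst e) = \<zeta> t \<omega> (snd e)" using con by (auto simp: consensus_def)
    then show ?thesis by (simp add: move_def active_edge_def)
  qed
  then have "\<zeta> s \<omega> = \<zeta> t \<omega>" if "t < s" for s
    using that \<open>0 \<le> t\<close> by (intro constant_if_absorbed) auto
  then have const: "\<forall>s>t. \<zeta> t \<omega> = \<zeta> s \<omega>" by metis
  show ?thesis
    using fixation_time_attained[OF f_right \<open>0 \<le> t\<close> const] con
    by (simp add: fixates_constant_def consensus_def)
qed

section \<open>Measurability of the fixation event\<close>

lemma state_event: "0 \<le> t \<Longrightarrow> {\<omega> \<in> space M. P (\<zeta> t \<omega>)} \<in> events"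
proof -
  assume t: "0 \<le> t"
  have "\<zeta> t -` {\<sigma> \<in> \<Omega>. P \<sigma>} \<inter> space M \<in> events"
    by (rule measurable_sets[OF state[OF t]]) auto
  moreover have "\<zeta> t -` {\<sigma> \<in> \<Omega>. P \<sigma>} \<inter> space M = {\<omega> \<in> space M. P (\<zeta> t \<omega>)}"
    using state_in[OF t] by blast
  ultimately show ?thesis by simp
qed

lemma equal_states_event:
  assumes "0 \<le> s" "0 \<le> t"
  shows "{\<omega> \<in> space M. \<zeta> s \<omega> = \<zeta> t \<omega>} \<in> events"
proof -
  have "{\<omega> \<in> space M. \<zeta> s \<omega> = \<zeta> t \<omega>}
    = (\<Union>\<sigma>\<in>\<Omega>. {\<omega> \<in> space M. \<zeta> s \<omega> = \<sigma>} \<inter> {\<omega> \<in> space M. \<zeta> t \<omega> = \<sigma>})" (is "?L = ?R")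
  proof (rule set_eqI)
    fix \<omega>
    show "\<omega> \<in> ?L \<longleftrightarrow> \<omega> \<in> ?R" using state_in[OF assms(1), of \<omega>] by (cases "\<omega> \<in> space M") auto
  qed
  also have "\<dots> \<in> events"
    by (intro sets.finite_UN finite_states sets.Int state_event assms)
  finally show ?thesis .
qed

lemma fixates_event: "{\<omega> \<in> space M. fixates_constant V S (\<lambda>t. \<zeta> t \<omega>)} \<in> events"
proof -
  have "{\<omega> \<in> space M. fixates_constant V S (\<lambda>t. \<zeta> t \<omega>)} = {\<omega> \<in> space M. \<exists>k::nat.
      consensus V S (\<zeta> (real k) \<omega>) \<and> (\<forall>q::rat. 0 \<le> q \<longrightarrow> \<zeta> (real k + of_rat q) \<omega> = \<zeta> (real k) \<omega>)}"
    using fixates_constant_iff[OF right_continuous] by blast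
  also have "\<dots> \<in> events"
  proof (intro sets.sets_Collect_countable_Ex sets.sets_Collect_conj sets.sets_Collect_countable_All)
    fix k :: nat and q :: rat
    show "{\<omega> \<in> space M. consensus V S (\<zeta> (real k) \<omega>)} \<in> events" by (rule state_event) simp
    show "{\<omega> \<in> space M. 0 \<le> q \<longrightarrow> \<zeta> (real k + of_rat q) \<omega> = \<zeta> (real k) \<omega>} \<in> events"
      by (cases "0 \<le> q") (auto intro!: equal_states_event)
  qed
  finally show ?thesis .
qed

text \<open>By linearity the expected total depth is a sum of one-site expectations, each equal to
  the mean depth of a uniform vertex.\<close>

lemma initial_total_depth:
  assumes "uniform_product_initial V S M (\<zeta> 0)"
  shows "(\<Sum>\<sigma>\<in>\<Omega>. total_depth S \<sigma> * prob {\<omega> \<in> space M. chain h 0 \<omega> = \<sigma>})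
    = real (card S) * ((\<Sum>k=1..r. real k * real n ^ k) / (\<Sum>k=0..r. real n ^ k))"
proof -
  let ?q = "\<lambda>\<sigma>. prob {\<omega> \<in> space M. chain h 0 \<omega> = \<sigma>}"
  have site: "(\<Sum>\<sigma>\<in>\<Omega>. real (length (\<sigma> x)) * ?q \<sigma>)
      = (\<Sum>k=1..r. real k * real n ^ k) / (\<Sum>k=0..r. real n ^ k)" if x: "x \<in> S" for x
  proof -
    have uniform: "prob {\<omega> \<in> space M. \<zeta> 0 \<omega> x = v} = 1 / real (card V)" if v: "v \<in> V" for v
    proof -
      have m: "(\<lambda>\<omega>. \<zeta> 0 \<omega> x) \<in> measurable M (count_space UNIV)"
        using measurable_compose[OF state[of 0], of "\<lambda>\<sigma>. \<sigma> x" "count_space UNIV"] by simp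
      have "distr M (count_space UNIV) (\<lambda>\<omega>. \<zeta> 0 \<omega> x) = measure_pmf (pmf_of_set V)"
        using assms x by (simp add: uniform_product_initial_def)
      then have "measure (measure_pmf (pmf_of_set V)) {v} = prob ((\<lambda>\<omega>. \<zeta> 0 \<omega> x) -` {v} \<inter> space M)"
        using measure_distr[OF m, of "{v}"] by simp
      moreover have "(\<lambda>\<omega>. \<zeta> 0 \<omega> x) -` {v} \<inter> space M = {\<omega> \<in> space M. \<zeta> 0 \<omega> x = v}" by auto
      moreover have "V \<noteq> {}" using v by auto
      ultimately show ?thesis
        using v finite_tree_vertices by (simp add: measure_pmf_single)
    qed
    have "(\<Sum>\<sigma>\<in>\<Omega>. real (length (\<sigma> x)) * ?q \<sigma>)
        = (\<Sum>v\<in>V. \<Sum>\<sigma> | \<sigma> \<in> \<Omega> \<and> \<sigma> x = v. real (length (\<sigma> x)) * ?q \<sigma>)"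
      using x by (intro sum.group[symmetric] finite_states finite_tree_vertices) auto
    also have "\<dots> = (\<Sum>v\<in>V. real (length v) * prob {\<omega> \<in> space M. \<zeta> 0 \<omega> x = v})"
    proof (rule sum.cong[OF refl])
      fix v
      have "(\<Sum>\<sigma> | \<sigma> \<in> \<Omega> \<and> \<sigma> x = v. real (length (\<sigma> x)) * ?q \<sigma>)
          = (\<Sum>\<sigma>\<in>\<Omega>. real (length v) * (of_bool (\<sigma> x = v) * ?q \<sigma>))"
        unfolding sum.inter_filter[OF finite_states] by (intro sum.cong) auto
      \<comment> \<open>The initial state does not depend on the slot length; length zero meets the
        sign condition of \<open>prob_chain_sum\<close>, as \<open>h\<close> is arbitrary
        here.\<close>
      also have "\<dots> = real (length v) * (\<Sum>\<sigma>\<in>\<Omega>. of_bool (\<sigma> x = v) * prob {\<omega> \<in> space M. chain 0 0 \<omega> = \<sigma>})"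
        by (simp add: sum_distrib_left)
      also have "\<dots> = real (length v) * prob {\<omega> \<in> space M. \<zeta> 0 \<omega> x = v}"
        using prob_chain_sum[of 0 "\<lambda>\<sigma>. \<sigma> x = v" 0] by simp
      finally show "(\<Sum>\<sigma> | \<sigma> \<in> \<Omega> \<and> \<sigma> x = v. real (length (\<sigma> x)) * ?q \<sigma>)
        = real (length v) * prob {\<omega> \<in> space M. \<zeta> 0 \<omega> x = v}" .
    qed
    also have "\<dots> = (\<Sum>v\<in>V. real (length v)) / real (card V)"
      using uniform by (simp add: sum_divide_distrib)
    also have "real (card V) = (\<Sum>k=0..r. real n ^ k)"
      using sum_tree_vertices_by_depth[of "\<lambda>_. 1" n r] by simp
    also have "(\<Sum>v\<in>V. real (length v)) = (\<Sum>k=1..r. real k * real n ^ k)"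
      using sum_tree_vertices_by_depth[of real n r]
      by (simp add: sum.atLeast_Suc_atMost mult.commute)
    finally show ?thesis .
  qed
  have "(\<Sum>\<sigma>\<in>\<Omega>. total_depth S \<sigma> * ?q \<sigma>) = (\<Sum>x\<in>S. \<Sum>\<sigma>\<in>\<Omega>. real (length (\<sigma> x)) * ?q \<sigma>)"
    unfolding total_depth_def sum_distrib_right by (rule sum.swap)
  then show ?thesis using site by simp
qed

text \<open>Unless one of the first \<open>m\<close> slots is crowded, the chain at step
  \<open>m\<close> agrees with the process, and its consensus is permanent. A union bound controls
  the crowded slots.\<close>

lemma fixates_ge_chain:
  assumes "0 < h"
  shows "prob {\<omega> \<in> space M. consensus V S (chain h m \<omega>)} - real m * (real (card K) * h)\<^sup>2
    \<le> prob {\<omega> \<in> space M. fixates_constant V S (\<lambda>t. \<zeta> t \<omega>)}" (is "prob ?C - _ \<le> prob ?F")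
proof -
  define B where "B k = space M - (no_activation h k \<union> (\<Union>e\<in>K. single_activation h k e))" for k
  have ev: "B k \<in> events" for k
    unfolding B_def using activation_events assms finite_edges
    by (intro sets.Diff sets.Un sets.finite_UN) auto
  have "AE \<omega> in M. \<omega> \<in> ?C \<longrightarrow> \<omega> \<in> ?F \<union> (\<Union>k<m. B k)"
    using AE_jump_path AE_space
  proof eventually_elim
    fix \<omega> assume path: "jump_path K (\<lambda>t. \<zeta> t \<omega>) (\<lambda>e t. N e t \<omega>) (move \<tau>)" and \<omega>: "\<omega> \<in> space M"
    show "\<omega> \<in> ?C \<longrightarrow> \<omega> \<in> ?F \<union> (\<Union>k<m. B k)"
    proof (intro impI, rule ccontr)
      assume C: "\<omega> \<in> ?C" and "\<omega> \<notin> ?F \<union> (\<Union>k<m. B k)"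
      then have "\<omega> \<in> no_activation h k \<union> (\<Union>e\<in>K. single_activation h k e)" if "k < m" for k
        using that \<omega> unfolding B_def by blast
      then have "\<zeta> (real m * h) \<omega> = chain h m \<omega>"
        using chain_eq_process[OF path \<omega>, of h m] assms by simp
      then have "\<omega> \<in> ?F"
        using consensus_fixates[OF path \<omega>, of "real m * h"] C assms by simp
      then show False using \<open>\<omega> \<notin> ?F \<union> (\<Union>k<m. B k)\<close> by blast
    qed
  qed
  then have "prob ?C \<le> prob (?F \<union> (\<Union>k<m. B k))"
    using ev by (intro finite_measure_mono_AE sets.Un fixates_event) auto
  also have "\<dots> \<le> prob ?F + prob (\<Union>k<m. B k)"
    using ev by (intro measure_Un_le fixates_event) auto
  also have "prob (\<Union>k<m. B k) \<le> (\<Sum>k<m. prob (B k))"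
    using ev by (intro finite_measure_subadditive_finite) auto
  also have "\<dots> \<le> (\<Sum>k<m. (real (card K) * h)\<^sup>2)"
    unfolding B_def by (intro sum_mono prob_many_activations_le assms)
  finally show ?thesis by simp
qed

text \<open>The chain yields the bound up to two errors: \<open>L / (m * jump_prob h)\<close> for
  not yet being frozen and \<open>m * (d * h)^2\<close> for crowded slots. Both vanish along a
  suitable sequence of \<open>h\<close> and \<open>m\<close>.\<close>

lemma prob_fixates_constant_ge:
  assumes "connected_graph S F" "r \<le> \<tau>" "uniform_product_initial V S M (\<zeta> 0)"
  shows "prob {\<omega> \<in> space M. fixates_constant V S (\<lambda>t. \<zeta> t \<omega>)}
    \<ge> 1 - 1 / (real \<tau> + 1 - real r) * ((\<Sum>k=1..r. real k * real n ^ k) / (\<Sum>k=0..r. real n ^ k))"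
    (is "?F \<ge> 1 - 1 / ?c * ?\<mu>")
proof -
  define d where "d = real (card K)"
  define L where "L = (real r * real (card S))\<^sup>2"
  have con: "1 - 1 / ?c * ?\<mu> - L / (real m * jump_prob h) \<le> prob {\<omega> \<in> space M. consensus V S (chain h m \<omega>)}"
    if "0 < h" "0 < m" for h m
  \<comment> \<open>Without sites consensus holds vacuously, with the root as witness; the
    comparison of depths divides by the number of sites.\<close>
  proof (cases "S = {}")
    case True
    then have "consensus V S \<sigma>" for \<sigma> using root_in_tree_vertices by (auto simp: consensus_def)
    moreover have "0 \<le> 1 / ?c * ?\<mu>" using \<open>r \<le> \<tau>\<close> by (intro mult_nonneg_nonneg divide_nonneg_nonneg sum_nonneg) auto
    ultimately show ?thesis by (simp add: prob_space L_def True)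
  next
    case False
    have "0 < jump_prob h" using that by (simp add: jump_prob_def)
    note bound = consensus_probability_ge[OF jump_chain_chain[OF \<open>0 < h\<close>] finite_sites False
        finite_edges edges_subset assms(1,2) this \<open>0 < m\<close>]
    have "card S \<noteq> 0" using False finite_sites by simp
    then show ?thesis
      using bound prob_chain_sum[of h "consensus V S" m] that
      unfolding initial_total_depth[OF assms(3)] by (simp add: L_def mult.commute)
  qed
  have "1 - 1 / ?c * ?\<mu> - (L * exp d + d\<^sup>2) / real j \<le> ?F" if "0 < j" for j :: nat
  proof -
    \<comment> \<open>This scaling gives \<open>m * h = j\<close> and
      \<open>m * h^2 = 1 / j\<close>, so both errors are of order \<open>1 / j\<close>.\<close>
    define h where "h = 1 / (real j)\<^sup>2"
    define m where "m = j ^ 3"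
    have hm: "0 < h" "0 < m" "h \<le> 1" using that by (auto simp: h_def m_def)
    have "real m * h = real j"
      using that by (simp add: h_def m_def power2_eq_square power3_eq_cube)
    then have mp: "real m * jump_prob h = real j * exp (- (d * h))"
      by (simp add: jump_prob_def d_def mult.assoc[symmetric])
    \<comment> \<open>Since \<open>h \<le> 1\<close>, the factor \<open>exp (- (d * h))\<close>
      stays above \<open>exp (- d)\<close> uniformly in \<open>j\<close>.\<close>
    have "d * h \<le> d" using hm by (intro mult_left_le) (auto simp: d_def)
    then have "exp (- d) \<le> exp (- (d * h))" by simp
    then have "real j * exp (- d) \<le> real m * jump_prob h" unfolding mp by (intro mult_left_mono) auto
    then have "L / (real m * jump_prob h) \<le> L / (real j * exp (- d))"
      using that by (intro divide_left_mono) (auto simp: L_def mp)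
    also have "\<dots> = L * exp d / real j" by (simp add: exp_minus field_simps)
    finally have 1: "L / (real m * jump_prob h) \<le> L * exp d / real j" .
    have "real m * (d * h)\<^sup>2 = d\<^sup>2 * (real m * h) * h" by (simp add: power2_eq_square)
    also have "\<dots> = d\<^sup>2 * (real j * h)" using \<open>real m * h = real j\<close> by simp
    also have "real j * h = 1 / real j" using that by (simp add: h_def power2_eq_square)
    finally have 2: "real m * (d * h)\<^sup>2 = d\<^sup>2 / real j" by simp
    show ?thesis
      using con[OF hm(1,2)] fixates_ge_chain[OF hm(1), of m] 1 2
      by (simp add: d_def add_divide_distrib)
  qed
  moreover have "(\<lambda>j. 1 - 1 / ?c * ?\<mu> - (L * exp d + d\<^sup>2) / real j) \<longlonglongrightarrow> 1 - 1 / ?c * ?\<mu> - 0"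
    by (intro tendsto_diff tendsto_const lim_const_over_n)
  ultimately have "1 - 1 / ?c * ?\<mu> - 0 \<le> ?F"
    by (intro LIMSEQ_le_const2[where a = ?F]) (auto intro!: exI[of _ 1])
  then show ?thesis by simp
qed

end

theorem theorem5:
  fixes n r \<tau> :: nat
    and S :: "'x set" and F :: "'x set set"
    and M :: "'w measure"
    and N :: "'x \<times> 'x \<Rightarrow> real \<Rightarrow> 'w \<Rightarrow> nat"
    and U :: "'x \<times> 'x \<Rightarrow> nat \<Rightarrow> nat list \<Rightarrow> nat list \<Rightarrow> 'w \<Rightarrow> nat list"
    and \<zeta> :: "real \<Rightarrow> 'w \<Rightarrow> 'x \<Rightarrow> nat list"
  assumes "2 \<le> n" and "1 \<le> r" and "r \<le> \<tau>" and "\<tau> < 2 * r"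
    and "simple_graph S F" and "finite S" and "connected_graph S F"
    and "attraction_process (tree_vertices n r) (tree_edges n r) S F \<tau> M N U \<zeta>"
    and "uniform_product_initial (tree_vertices n r) S M (\<zeta> 0)"
  shows "measure M {\<omega> \<in> space M. fixates_constant (tree_vertices n r) S (\<lambda>t. \<zeta> t \<omega>)}
      \<ge> 1 - 1 / (real \<tau> + 1 - real r) *
          ((\<Sum>k=1..r. real k * real n ^ k) / (\<Sum>k=0..r. real n ^ k))
    \<and> 1 - 1 / (real \<tau> + 1 - real r) *
          ((\<Sum>k=1..r. real k * real n ^ k) / (\<Sum>k=0..r. real n ^ k))
      = 1 - 1 / (real \<tau> + 1 - real r) *
          (real n * (real r * real n ^ (r + 1) - (real r + 1) * real n ^ r + 1) /
            ((1 - real n) * (1 - real n ^ (r + 1))))"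
proof (rule conjI)
  interpret attraction_process "tree_vertices n r" "tree_edges n r" S F \<tau> M N U \<zeta> by fact
  interpret tree_attraction n r \<tau> S F M N U \<zeta>
    by unfold_locales (use assms in auto)
  show "measure M {\<omega> \<in> space M. fixates_constant (tree_vertices n r) S (\<lambda>t. \<zeta> t \<omega>)}
      \<ge> 1 - 1 / (real \<tau> + 1 - real r) *
          ((\<Sum>k=1..r. real k * real n ^ k) / (\<Sum>k=0..r. real n ^ k))"
    using assms by (intro prob_fixates_constant_ge)
  have "1 < real n" using \<open>2 \<le> n\<close> by simp
  from mean_depth_closed_form[OF this, of r]
  show "1 - 1 / (real \<tau> + 1 - real r) *
          ((\<Sum>k=1..r. real k * real n ^ k) / (\<Sum>k=0..r. real n ^ k))
      = 1 - 1 / (real \<tau> + 1 - real r) *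
          (real n * (real r * real n ^ (r + 1) - (real r + 1) * real n ^ r + 1) /
            ((1 - real n) * (1 - real n ^ (r + 1))))" by (simp only:)
qed

end
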